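(* Let $A$ be a densely defined symmetric operator on a complex Hilbert space $\mathcal{H}$ with equal finite deficiency indices $d_+ = d_- = d < \infty$. Suppose that there exists a self-adjoint extension $A_0$ of $A$ such that (i) $A_0$ has compact resolvent, and (ii) $A_0$ is semibounded. Then: (1) Every other self-adjoint extension of $A$ also has compact resolvent and is semibounded. (2) For every other self-adjoint extension $A_1$ of $A$, $$\forall E \in \mathbb{R}, \quad |N_1(E) - N_0(E)| \le d,$$ where $N_i$ denotes the spectral counting function of $A_i$, $i = 0,1$.
   Context: Let $\mathcal{H}$ be a complex Hilbert space with scalar product $\langle\cdot,\cdot\rangle$ and norm $\|\cdot\|$. For a symmetric operator $A$ with domain $\operatorname{dom}(A)$ and adjoint $A^*$, set $\mathcal{K}^{\pm} = \ker(A^* \mp i\,\mathrm{id})$; the deficiency indices are $d_\pm = \dim \mathcal{K}^\pm$. A self-adjoint operator $B$ has compact resolvent if the injection from $\operatorname{dom}(B)$, equipped with the graph norm $\|u\|_B^2 = \|u\|^2 + \|Bu\|^2$, into $\mathcal{H}$ is compact. A self-adjoint operator $B$ is semibounded if there exists $C \in \mathbb{R}$ such that $\langle Bu,u\rangle \ge C\|u\|^2$ for all $u \in \operatorname{dom}(B)$. For a semibounded self-adjoint operator $B$ with compact resolvent, the spectrum is a non-decreasing sequence $(\lambda_n)$ of eigenvalues, repeated according to multiplicity, and the spectral counting function is $N(E) = \operatorname{Card}\{n : \lambda_n \le E\}$. *)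

theory Defs
  imports "HOL-Analysis.Analysis"
begin

text \<open>
  The inner product is linear in its first argument. Positivity, definiteness and compatibility
  with the norm are all contained in \<open>cinner_self\<close>; the remaining module law
  \<open>1 x = x\<close> follows from \<open>scaleR_scaleC\<close>.
\<close>

class complex_inner = real_normed_vector +
  fixes scaleC :: "complex \<Rightarrow> 'a \<Rightarrow> 'a" (infixr \<open>*\<^sub>C\<close> 75)
    and cinner :: "'a \<Rightarrow> 'a \<Rightarrow> complex"
  assumes scaleC_add_right: "a *\<^sub>C (x + y) = a *\<^sub>C x + a *\<^sub>C y"
    and scaleC_add_left: "(a + b) *\<^sub>C x = a *\<^sub>C x + b *\<^sub>C x"
    and scaleC_scaleC: "a *\<^sub>C (b *\<^sub>C x) = (a * b) *\<^sub>C x"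
    and scaleR_scaleC: "r *\<^sub>R x = complex_of_real r *\<^sub>C x"
    and cinner_commute: "cinner x y = cnj (cinner y x)"
    and cinner_add_left: "cinner (x + y) z = cinner x z + cinner y z"
    and cinner_scaleC_left: "cinner (a *\<^sub>C x) y = a * cinner x y"
    and cinner_self: "cinner x x = complex_of_real ((norm x)\<^sup>2)"

class chilbert_space = complex_inner + complete_space

lemma scaleC_one: "1 *\<^sub>C x = (x :: 'a::complex_inner)"
  using scaleR_scaleC[of 1 x] by simp

global_interpretation complex_vector: vector_space "scaleC :: complex \<Rightarrow> 'a \<Rightarrow> 'a::complex_inner"
  defines csubspace = complex_vector.subspace
    and cspan = complex_vector.span
    and cdim = complex_vector.dim
  by unfold_locales (simp_all add: scaleC_add_right scaleC_add_left scaleC_scaleC scaleC_one)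

text \<open>The library dimension of an infinite-dimensional space is 0, hence the following variant.\<close>

definition ecdim :: "'a::complex_inner set \<Rightarrow> enat" where
  "ecdim S = (if \<exists>B. finite B \<and> S \<subseteq> cspan B then enat (cdim S) else \<infinity>)"

instantiation complex :: chilbert_space
begin

definition scaleC_complex :: "complex \<Rightarrow> complex \<Rightarrow> complex" where
  "scaleC_complex a x = a * x"

definition cinner_complex :: "complex \<Rightarrow> complex \<Rightarrow> complex" where
  "cinner_complex x y = x * cnj y"

instance
  by standard
    (simp_all add: scaleC_complex_def cinner_complex_def algebra_simps scaleR_conv_of_real
      complex_norm_square del: of_real_power)

end

text \<open>
  An operator is a partial function \<open>A :: 'a \<rightharpoonup> 'a\<close>: its domain is \<open>dom A\<close>, its value at
  \<open>u \<in> dom A\<close> is \<open>the (A u)\<close>, equality includes equality of domains, and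
  \<open>A \<subseteq>\<^sub>m B\<close> says that \<open>B\<close> extends \<open>A\<close>.
\<close>

definition linear_op :: "('a::complex_inner \<rightharpoonup> 'a) \<Rightarrow> bool" where
  "linear_op A \<longleftrightarrow> csubspace (dom A) \<and>
     (\<forall>u\<in>dom A. \<forall>v\<in>dom A. the (A (u + v)) = the (A u) + the (A v)) \<and>
     (\<forall>c. \<forall>u\<in>dom A. the (A (c *\<^sub>C u)) = c *\<^sub>C the (A u))"

definition densely_defined :: "('a::complex_inner \<rightharpoonup> 'a) \<Rightarrow> bool" where
  "densely_defined A \<longleftrightarrow> closure (dom A) = UNIV"

definition symmetric_op :: "('a::complex_inner \<rightharpoonup> 'a) \<Rightarrow> bool" where
  "symmetric_op A \<longleftrightarrow> linear_op A \<and>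
     (\<forall>u\<in>dom A. \<forall>v\<in>dom A. cinner (the (A u)) v = cinner u (the (A v)))"

text \<open>The description below is unique, and the definition meaningful, only for densely defined
  \<open>A\<close>.\<close>

definition adjoint_op :: "('a::complex_inner \<rightharpoonup> 'a) \<Rightarrow> ('a \<rightharpoonup> 'a)" where
  "adjoint_op A = (\<lambda>v.
     if \<exists>w. \<forall>u\<in>dom A. cinner (the (A u)) v = cinner u w
     then Some (THE w. \<forall>u\<in>dom A. cinner (the (A u)) v = cinner u w) else None)"

definition selfadjoint_op :: "('a::complex_inner \<rightharpoonup> 'a) \<Rightarrow> bool" where
  "selfadjoint_op A \<longleftrightarrow> linear_op A \<and> densely_defined A \<and> adjoint_op A = A"

definition selfadjoint_extension :: "('a::complex_inner \<rightharpoonup> 'a) \<Rightarrow> ('a \<rightharpoonup> 'a) \<Rightarrow> bool" where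
  "selfadjoint_extension A B \<longleftrightarrow> selfadjoint_op B \<and> A \<subseteq>\<^sub>m B"

definition shift_op :: "('a::complex_inner \<rightharpoonup> 'a) \<Rightarrow> complex \<Rightarrow> ('a \<rightharpoonup> 'a)" where
  "shift_op A z = (\<lambda>u. map_option (\<lambda>w. w - z *\<^sub>C u) (A u))"

definition ker_op :: "('a::complex_inner \<rightharpoonup> 'a) \<Rightarrow> 'a set" where
  "ker_op A = {u \<in> dom A. the (A u) = 0}"

definition deficiency_index_plus :: "('a::complex_inner \<rightharpoonup> 'a) \<Rightarrow> enat" where
  "deficiency_index_plus A = ecdim (ker_op (shift_op (adjoint_op A) \<i>))"

definition deficiency_index_minus :: "('a::complex_inner \<rightharpoonup> 'a) \<Rightarrow> enat" where
  "deficiency_index_minus A = ecdim (ker_op (shift_op (adjoint_op A) (- \<i>)))"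

definition graph_norm :: "('a::complex_inner \<rightharpoonup> 'a) \<Rightarrow> 'a \<Rightarrow> real" where
  "graph_norm B u = sqrt ((norm u)\<^sup>2 + (norm (the (B u)))\<^sup>2)"

text \<open>Compactness of the injection: sets bounded in the graph norm are relatively compact in the
  ambient space.\<close>

definition compact_resolvent :: "('a::complex_inner \<rightharpoonup> 'a) \<Rightarrow> bool" where
  "compact_resolvent B \<longleftrightarrow>
     (\<forall>S. S \<subseteq> dom B \<and> (\<exists>C. \<forall>u\<in>S. graph_norm B u \<le> C) \<longrightarrow> compact (closure S))"

text \<open>For self-adjoint \<open>B\<close> the number \<open>\<langle>B u, u\<rangle>\<close> is real, so that taking the real part
  loses nothing.\<close>

definition semibounded :: "('a::complex_inner \<rightharpoonup> 'a) \<Rightarrow> bool" where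
  "semibounded B \<longleftrightarrow> (\<exists>C::real. \<forall>u\<in>dom B. Re (cinner (the (B u)) u) \<ge> C * (norm u)\<^sup>2)"

definition resolvent_set_op :: "('a::complex_inner \<rightharpoonup> 'a) \<Rightarrow> complex set" where
  "resolvent_set_op B = {z.
     bij_betw (\<lambda>u. the (shift_op B z u)) (dom B) UNIV \<and>
     (\<exists>C. \<forall>u\<in>dom B. norm u \<le> C * norm (the (shift_op B z u)))}"

definition spectrum_op :: "('a::complex_inner \<rightharpoonup> 'a) \<Rightarrow> complex set" where
  "spectrum_op B = - resolvent_set_op B"

text \<open>
  The sequence \<open>l\<close> is indexed by an initial segment \<open>I\<close> of the natural numbers, which is finite
  when the space is finite-dimensional. Every real number occurs in it as often as the dimension
  of its eigenspace says; in particular, all values are eigenvalues.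
\<close>

definition eigenvalue_sequence ::
    "('a::complex_inner \<rightharpoonup> 'a) \<Rightarrow> nat set \<Rightarrow> (nat \<Rightarrow> real) \<Rightarrow> bool" where
  "eigenvalue_sequence B I l \<longleftrightarrow>
     (I = UNIV \<or> (\<exists>m. I = {..<m})) \<and>
     mono_on I l \<and>
     spectrum_op B = complex_of_real ` l ` I \<and>
     (\<forall>\<mu>. finite {n \<in> I. l n = \<mu>} \<and>
        enat (card {n \<in> I. l n = \<mu>}) = ecdim (ker_op (shift_op B (complex_of_real \<mu>))))"

text \<open>
  For semibounded self-adjoint \<open>B\<close> with compact resolvent an eigenvalue sequence exists, its
  values on the index set are unique, and the counted sets are finite.
\<close>

definition counting_function :: "('a::complex_inner \<rightharpoonup> 'a) \<Rightarrow> real \<Rightarrow> nat" where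
  "counting_function B E =
     (THE N. \<exists>I l. eigenvalue_sequence B I l \<and> N = card {n \<in> I. l n \<le> E})"

end

theory Submission
  imports Defs
begin

text \<open>
  Two self-adjoint extensions \<open>B0\<close> and \<open>B1\<close> of \<open>A\<close> are both restrictions of the adjoint of \<open>A\<close>. Hence, if
  \<open>(B1 - \<i>) u = (B0 - \<i>) v\<close>, then \<open>u - v\<close> lies in the deficiency space \<open>ker (A\<^sup>* - \<i>)\<close>, whose dimension is \<open>d\<close>:
  the resolvents at \<open>\<i>\<close> differ by an operator of rank at most \<open>d\<close> (\<open>finite_rank_pair_of_extensions\<close>). So
  the operators agree on the subspace of \<open>dom B1\<close> cut out by \<open>d\<close> linear functionals
  (\<open>common_combination\<close>), and each assertion is a consequence of this.

  Compactness of the resolvent passes from \<open>B0\<close> to \<open>B1\<close> because a bounded operator of finite rank is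
  compact. Semiboundedness passes over because the form of \<open>B1 - C\<close>, being nonnegative on a
  subspace of codimension at most \<open>d\<close>, has at most \<open>d\<close> negative squares, each of which contributes a bounded
  amount (\<open>semibounded_transfer\<close>). The bound on the counting functions is Glazman's argument: the
  form of \<open>B1\<close> is at most \<open>E\<close> on the span of its \<open>N\<^sub>1(E)\<close> eigenvectors up to \<open>E\<close>, the form of \<open>B0\<close> exceeds
  \<open>E\<close> on the orthogonal complement of its \<open>N\<^sub>0(E)\<close> eigenvectors up to \<open>E\<close>, and if \<open>N\<^sub>1(E) > N\<^sub>0(E) + d\<close> a
  dimension count produces a nonzero vector in both subspaces at which the operators agree
  (\<open>counting_function_le\<close>). Exchanging \<open>B0\<close> and \<open>B1\<close> gives the other inequality.

  The strict bound on the complement is usually read off from an orthonormal basis of eigenvectors.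
  Here it is proved directly (\<open>form_gt_on_complement\<close>): the infimum of the quotient
  \<open>\<langle>B u, u\<rangle> / \<parallel>u\<parallel>\<^sup>2\<close> on the complement belongs to the spectrum of the part of \<open>B\<close> there, which by compactness
  consists of eigenvalues, and those are greater than \<open>E\<close>. A maximal orthonormal set of
  eigenvectors therefore suffices to compute the counting function (\<open>counting_function_eq_card\<close>).
\<close>

section \<open>Complex inner product spaces\<close>

lemma cinner_add_right: "cinner x (y + z) = cinner x y + cinner x (z :: 'a::complex_inner)"
  by (metis cinner_add_left cinner_commute complex_cnj_add)

lemma cinner_scaleC_right: "cinner x (a *\<^sub>C y) = cnj a * cinner x (y :: 'a::complex_inner)"
  by (metis cinner_scaleC_left cinner_commute complex_cnj_mult)

lemma norm_scaleC: "norm (a *\<^sub>C x) = cmod a * norm (x :: 'a::complex_inner)"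
proof -
  have "complex_of_real ((norm (a *\<^sub>C x))\<^sup>2) = a * cnj a * complex_of_real ((norm x)\<^sup>2)"
    by (simp only: cinner_self[symmetric] cinner_scaleC_left cinner_scaleC_right mult_ac)
  also have "\<dots> = complex_of_real ((cmod a * norm x)\<^sup>2)"
    by (simp add: complex_norm_square[symmetric] power_mult_distrib)
  finally have "(norm (a *\<^sub>C x))\<^sup>2 = (cmod a * norm x)\<^sup>2"
    using of_real_eq_iff by blast
  then show ?thesis by (simp add: power2_eq_iff_nonneg)
qed

lemma Re_cinner_self: "Re (cinner x x) = (norm (x :: 'a::complex_inner))\<^sup>2"
  by (simp add: cinner_self del: of_real_power)

lemma Re_cinner_commute: "Re (cinner x y) = Re (cinner y (x :: 'a::complex_inner))"
  by (subst cinner_commute) simp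

lemma norm_sq_add:
  "(norm (x + y))\<^sup>2 = (norm x)\<^sup>2 + 2 * Re (cinner x y) + (norm (y :: 'a::complex_inner))\<^sup>2"
proof -
  have "(norm (x + y))\<^sup>2 = Re (cinner (x + y) (x + y))" by (simp add: Re_cinner_self)
  also have "\<dots> = Re (cinner x x) + (Re (cinner x y) + Re (cinner y x)) + Re (cinner y y)"
    by (simp add: cinner_add_left cinner_add_right)
  finally show ?thesis by (simp add: Re_cinner_self Re_cinner_commute[of y x])
qed

lemma scaleC_minus_one: "(- 1) *\<^sub>C x = - (x :: 'a::complex_inner)"
  using scaleR_scaleC[of "- 1" x] by simp

lemma norm_sq_diff_scaleC:
  fixes x y :: "'a::complex_inner"
  shows "(norm (x - a *\<^sub>C y))\<^sup>2 = (norm x)\<^sup>2 - 2 * Re (cnj a * cinner x y) + (cmod a)\<^sup>2 * (norm y)\<^sup>2"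
proof -
  have "x - a *\<^sub>C y = x + (- a) *\<^sub>C y"
    using scaleC_scaleC[of "- 1" a y] by (simp add: scaleC_minus_one)
  then have "(norm (x - a *\<^sub>C y))\<^sup>2 = (norm (x + (- a) *\<^sub>C y))\<^sup>2" by (rule arg_cong)
  also have "\<dots> = (norm x)\<^sup>2 - 2 * Re (cnj a * cinner x y) + (cmod a)\<^sup>2 * (norm y)\<^sup>2"
    by (simp add: norm_sq_add cinner_scaleC_right norm_scaleC power_mult_distrib
        del: complex_vector.scale_minus_left)
  finally show ?thesis .
qed

lemma norm_cinner_le: "cmod (cinner x y) \<le> norm x * norm (y :: 'a::complex_inner)"
proof (cases "y = 0")
  case True
  then show ?thesis
    using cinner_add_right[of x 0 0] by simp
next
  case False
  define t where "t = cinner x y / complex_of_real ((norm y)\<^sup>2)"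
  have "cnj t * cinner x y = complex_of_real ((cmod (cinner x y))\<^sup>2 / (norm y)\<^sup>2)"
    by (simp add: t_def complex_norm_square mult.commute del: of_real_power)
  moreover have "(cmod t)\<^sup>2 * (norm y)\<^sup>2 = (cmod (cinner x y))\<^sup>2 / (norm y)\<^sup>2"
  proof -
    have "cmod t = cmod (cinner x y) / (norm y)\<^sup>2"
      by (simp add: t_def norm_divide del: of_real_power)
    with False show ?thesis by (simp add: power2_eq_square)
  qed
  moreover have "0 \<le> (norm (x - t *\<^sub>C y))\<^sup>2" by simp
  ultimately have "(cmod (cinner x y))\<^sup>2 / (norm y)\<^sup>2 \<le> (norm x)\<^sup>2"
    unfolding norm_sq_diff_scaleC by simp
  then have "(cmod (cinner x y))\<^sup>2 \<le> (norm x * norm y)\<^sup>2"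
    using False by (simp add: field_simps power_mult_distrib)
  then show ?thesis by (simp add: power2_le_iff_abs_le)
qed

interpretation cinner: bounded_bilinear "cinner :: 'a::complex_inner \<Rightarrow> 'a \<Rightarrow> complex"
proof
  show "\<exists>K. \<forall>a b :: 'a. norm (cinner a b) \<le> norm a * norm b * K"
    by (rule exI[of _ 1]) (simp add: norm_cinner_le)
qed (simp_all add: cinner_add_left cinner_add_right scaleR_scaleC[where 'a='a] cinner_scaleC_left
    cinner_scaleC_right scaleR_conv_of_real)

interpretation scaleC: bounded_bilinear "scaleC :: complex \<Rightarrow> 'a \<Rightarrow> 'a::complex_inner"
proof
  show "\<exists>K. \<forall>a. \<forall>b :: 'a. norm (a *\<^sub>C b) \<le> norm a * norm b * K"
    by (rule exI[of _ 1]) (simp add: norm_scaleC)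
qed (simp_all add: scaleC_add_left scaleC_add_right scaleR_scaleC[where 'a='a] scaleC_scaleC
    scaleR_conv_of_real mult.commute)

text \<open>By continuity, a vector is determined by its inner products with a dense set; this makes the
  adjoint of a densely defined operator single-valued.\<close>

lemma closure_cinner_eq_0:
  fixes S :: "'a::complex_inner set"
  assumes "\<And>s. s \<in> S \<Longrightarrow> cinner s x = 0" "y \<in> closure S"
  shows "cinner y x = 0"
proof -
  from assms(2) obtain s where s: "\<And>n. s n \<in> S" "s \<longlonglongrightarrow> y"
    unfolding closure_sequential by blast
  have "(\<lambda>n. cinner (s n) x) \<longlonglongrightarrow> cinner y x"
    by (intro cinner.tendsto s tendsto_const)
  with s(1) assms(1) show ?thesis by (simp add: LIMSEQ_const_iff)
qed

lemma dense_cinner_eq_0: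
  fixes S :: "'a::complex_inner set"
  assumes "closure S = UNIV" "\<And>s. s \<in> S \<Longrightarrow> cinner s x = 0"
  shows "x = 0"
proof -
  have "cinner x x = 0" using closure_cinner_eq_0[of S x x] assms by simp
  then show ?thesis by (simp add: cinner_self)
qed

lemma csubspace_simps:
  assumes "csubspace (M :: 'a::complex_inner set)"
  shows csubspace_0: "0 \<in> M"
    and csubspace_add: "x \<in> M \<Longrightarrow> y \<in> M \<Longrightarrow> x + y \<in> M"
    and csubspace_diff: "x \<in> M \<Longrightarrow> y \<in> M \<Longrightarrow> x - y \<in> M"
    and csubspace_scaleC: "x \<in> M \<Longrightarrow> c *\<^sub>C x \<in> M"
    and csubspace_sum: "(\<And>i. i \<in> I \<Longrightarrow> f i \<in> M) \<Longrightarrow> sum f I \<in> M"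
  using assms complex_vector.subspace_0 complex_vector.subspace_add complex_vector.subspace_diff
    complex_vector.subspace_scale complex_vector.subspace_sum by metis+

definition orthogonal_complement :: "'a::complex_inner set \<Rightarrow> 'a set" where
  "orthogonal_complement S = {x. \<forall>s\<in>S. cinner x s = 0}"

lemma csubspace_orthogonal_complement: "csubspace (orthogonal_complement S)"
  by (rule complex_vector.subspaceI)
    (simp_all add: orthogonal_complement_def cinner.zero_left cinner_add_left cinner_scaleC_left)

lemma closed_orthogonal_complement: "closed (orthogonal_complement S)"
proof -
  have "orthogonal_complement S = (\<Inter>s\<in>S. {x. cinner x s = 0})"
    by (auto simp: orthogonal_complement_def)
  moreover have "closed {x :: 'a. cinner x s = 0}" for s
    by (intro closed_Collect_eq cinner.continuous_on continuous_intros)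
  ultimately show ?thesis by auto
qed

text \<open>The nearest point of \<open>M\<close>: the parallelogram law turns a minimizing sequence into a Cauchy sequence, and
  the residual of a nearest point is orthogonal to \<open>M\<close>, since otherwise a small step inside \<open>M\<close> would
  come closer.\<close>

theorem orthogonal_projection_exists:
  fixes M :: "'a::chilbert_space set"
  assumes M: "csubspace M" and cl: "closed M"
  obtains y where "y \<in> M" "x - y \<in> orthogonal_complement M"
proof -
  define d where "d = Inf ((\<lambda>m. (norm (x - m))\<^sup>2) ` M)"
  have bdd: "bdd_below ((\<lambda>m. (norm (x - m))\<^sup>2) ` M)" by (rule bdd_belowI[of _ 0]) auto
  have ne: "(\<lambda>m. (norm (x - m))\<^sup>2) ` M \<noteq> {}" using csubspace_0[OF M] by auto
  have d_le: "d \<le> (norm (x - m))\<^sup>2" if "m \<in> M" for m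
    unfolding d_def using bdd that by (intro cInf_lower) auto
  have "\<exists>m\<in>M. (norm (x - m))\<^sup>2 < d + 1 / real (Suc n)" for n
  proof -
    have "Inf ((\<lambda>m. (norm (x - m))\<^sup>2) ` M) < d + 1 / real (Suc n)" by (simp add: d_def)
    from cInf_lessD[OF ne this] show ?thesis by blast
  qed
  then obtain m where m: "\<And>n. m n \<in> M" "\<And>n. (norm (x - m n))\<^sup>2 < d + 1 / real (Suc n)" by metis
  have par: "(norm (m k - m n))\<^sup>2 \<le> 2 * (1 / real (Suc k)) + 2 * (1 / real (Suc n))" for k n
  proof -
    \<comment> \<open>the midpoint lies in \<open>M\<close>, so its distance from \<open>x\<close> is bounded below by the infimum\<close>
    define c where "c = (1 / 2 :: complex) *\<^sub>C (m k + m n)"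
    have "c \<in> M" unfolding c_def by (intro csubspace_scaleC csubspace_add M m)
    have "2 *\<^sub>C c = m k + m n" by (simp add: c_def scaleC_scaleC scaleC_one)
    have "2 *\<^sub>C (x - c) = (x - m k) + (x - m n)"
    proof -
      have "2 *\<^sub>C x = x + x" using scaleC_add_left[of 1 1 x] by (simp add: scaleC_one)
      then show ?thesis using \<open>2 *\<^sub>C c = m k + m n\<close> by (simp add: scaleC.diff_right)
    qed
    then have 1: "4 * (norm (x - c))\<^sup>2 = (norm ((x - m k) + (x - m n)))\<^sup>2"
      by (metis norm_scaleC norm_numeral power2_eq_square power_mult_distrib
          numeral_times_numeral semiring_norm(13,11,12))
    have 2: "(norm (m k - m n))\<^sup>2
        = (norm (x - m n))\<^sup>2 - 2 * Re (cinner (x - m n) (x - m k)) + (norm (x - m k))\<^sup>2"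
      using norm_sq_diff_scaleC[of "x - m n" 1 "x - m k"] by (simp add: scaleC_one)
    show ?thesis
      using 1 2 d_le[OF \<open>c \<in> M\<close>] m(2)[of k] m(2)[of n]
        norm_sq_add[of "x - m k" "x - m n"] Re_cinner_commute[of "x - m n" "x - m k"]
      by linarith
  qed
  have "Cauchy m"
  proof (rule metric_CauchyI)
    fix e :: real assume "e > 0"
    then obtain N where N: "1 / real (Suc N) < e\<^sup>2 / 4"
      using nat_approx_posE[of "e\<^sup>2 / 4"] by (metis divide_pos_pos zero_less_numeral zero_less_power)
    have "dist (m k) (m n) < e" if "k \<ge> N" "n \<ge> N" for k n
    proof -
      have "1 / real (Suc k) \<le> 1 / real (Suc N)" "1 / real (Suc n) \<le> 1 / real (Suc N)"
        using that by (simp_all add: frac_le)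
      with par[of k n] N have "(norm (m k - m n))\<^sup>2 < e\<^sup>2" by linarith
      with \<open>e > 0\<close> show ?thesis
        by (simp add: dist_norm power_less_imp_less_base)
    qed
    then show "\<exists>N. \<forall>k\<ge>N. \<forall>n\<ge>N. dist (m k) (m n) < e" by blast
  qed
  then obtain y where y: "m \<longlonglongrightarrow> y" using Cauchy_convergent convergent_def by blast
  have "y \<in> M" using closed_sequentially[OF cl] m(1) y by blast
  have "(norm (x - y))\<^sup>2 \<le> d + 0"
  proof (rule LIMSEQ_le)
    show "(\<lambda>n. (norm (x - m n))\<^sup>2) \<longlonglongrightarrow> (norm (x - y))\<^sup>2" by (intro tendsto_intros y)
    show "(\<lambda>n. d + 1 / real (Suc n)) \<longlonglongrightarrow> d + 0"
      using tendsto_add[OF tendsto_const[of d] lim_inverse_n'[THEN LIMSEQ_Suc]] by simp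
    show "\<exists>N. \<forall>n\<ge>N. (norm (x - m n))\<^sup>2 \<le> d + 1 / real (Suc n)" using m(2) less_imp_le by blast
  qed
  then have min: "(norm (x - y))\<^sup>2 \<le> (norm (x - y - a *\<^sub>C v))\<^sup>2" if "v \<in> M" for a v
    using d_le[OF csubspace_add[OF M \<open>y \<in> M\<close> csubspace_scaleC[OF M that]], of a]
    by (simp add: diff_diff_eq del: power_mono_iff)
  have "cinner (x - y) v = 0" if v: "v \<in> M" for v
  proof (rule ccontr)
    assume *: "cinner (x - y) v \<noteq> 0"
    then have "v \<noteq> 0" by (auto simp: cinner.zero_right)
    define s where "s = cinner (x - y) v"
    define t where "t = 1 / (norm v)\<^sup>2"
    have "t > 0" using \<open>v \<noteq> 0\<close> by (simp add: t_def)
    have "Re (cnj (t *\<^sub>R s) * s) = t * (cmod s)\<^sup>2"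
      by (simp add: scaleR_conv_of_real cmod_power2 algebra_simps flip: power2_eq_square)
    moreover have "(cmod (t *\<^sub>R s))\<^sup>2 * (norm v)\<^sup>2 = t * (cmod s)\<^sup>2"
      using \<open>v \<noteq> 0\<close> by (simp add: t_def power_mult_distrib power2_eq_square)
    ultimately have "t * (cmod s)\<^sup>2 \<le> 0"
      using min[OF v, of "t *\<^sub>R s"] unfolding norm_sq_diff_scaleC s_def[symmetric] by linarith
    with \<open>t > 0\<close> * show False by (simp add: mult_le_0_iff s_def)
  qed
  with \<open>y \<in> M\<close> show thesis
    by (intro that[of y]) (auto simp: orthogonal_complement_def)
qed

section \<open>Orthonormal sets\<close>

definition orthonormal :: "'a::complex_inner set \<Rightarrow> bool" where
  "orthonormal P \<longleftrightarrow> (\<forall>x\<in>P. \<forall>y\<in>P. cinner x y = (if x = y then 1 else 0))"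

lemma orthonormal_subset: "orthonormal P \<Longrightarrow> Q \<subseteq> P \<Longrightarrow> orthonormal Q"
  unfolding orthonormal_def by blast

lemma orthonormal_norm: "orthonormal P \<Longrightarrow> x \<in> P \<Longrightarrow> norm x = 1"
  using cinner_self[of x] norm_ge_zero[of x]
  by (simp add: orthonormal_def power2_eq_1_iff del: of_real_power)

lemma cinner_sum_orthonormal:
  assumes "orthonormal P" "finite P" "t \<in> P"
  shows "cinner (\<Sum>s\<in>P. c s *\<^sub>C s) t = c t"
proof -
  have "cinner (\<Sum>s\<in>P. c s *\<^sub>C s) t = (\<Sum>s\<in>P. if s = t then c s else 0)"
    unfolding cinner.sum_left cinner_scaleC_left
    using assms by (intro sum.cong) (auto simp: orthonormal_def)
  then show ?thesis using assms by simp
qed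

lemma independent_orthonormal:
  assumes P: "orthonormal P"
  shows "\<not> complex_vector.dependent P"
proof
  assume "complex_vector.dependent P"
  then obtain S u v where S: "finite S" "S \<subseteq> P" "(\<Sum>v\<in>S. u v *\<^sub>C v) = 0" "v \<in> S" "u v \<noteq> 0"
    unfolding complex_vector.dependent_explicit by blast
  have "orthonormal S" using P S(2) unfolding orthonormal_def by blast
  from cinner_sum_orthonormal[OF this S(1) S(4), of u] S show False
    by (simp add: cinner.zero_left)
qed

text \<open>Zorn's lemma. Maximality is recorded in the form in which it is applied: adjoining a unit vector of
  \<open>X\<close> orthogonal to \<open>P\<close> would give a larger orthonormal subset.\<close>

lemma maximal_orthonormal_subset:
  obtains P where "P \<subseteq> X" "orthonormal P" 
    "\<And>x. x \<in> X \<Longrightarrow> norm x = 1 \<Longrightarrow> x \<notin> orthogonal_complement P"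
proof -
  let ?F = "{P. P \<subseteq> X \<and> orthonormal P}"
  have "\<exists>P\<in>?F. \<forall>Q\<in>?F. P \<subseteq> Q \<longrightarrow> Q = P"
  proof (rule subset_Zorn)
    fix C assume C: "subset.chain ?F C"
    have "orthonormal (\<Union>C)"
      unfolding orthonormal_def
    proof (intro ballI)
      fix x y assume "x \<in> \<Union>C" "y \<in> \<Union>C"
      then obtain Q R where "Q \<in> C" "x \<in> Q" "R \<in> C" "y \<in> R" by blast
      moreover from this have "Q \<subseteq> R \<or> R \<subseteq> Q" using C unfolding subset.chain_def by blast
      ultimately obtain Q where "Q \<in> C" "x \<in> Q" "y \<in> Q" by blast
      moreover from \<open>Q \<in> C\<close> have "orthonormal Q" using C by (auto simp: subset.chain_def)
      ultimately show "cinner x y = (if x = y then 1 else 0)" by (simp add: orthonormal_def)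
    qed
    moreover have "\<Union>C \<subseteq> X" using C unfolding subset.chain_def by blast
    ultimately show "\<exists>U\<in>?F. \<forall>Q\<in>C. Q \<subseteq> U" by blast
  qed
  then obtain P where P: "P \<subseteq> X" "orthonormal P"
    and max: "\<And>Q. Q \<subseteq> X \<Longrightarrow> orthonormal Q \<Longrightarrow> P \<subseteq> Q \<Longrightarrow> Q = P" by auto
  have "x \<notin> orthogonal_complement P" if x: "x \<in> X" "norm x = 1" for x
  proof
    assume *: "x \<in> orthogonal_complement P"
    have xx: "cinner x x = 1" using x by (simp add: cinner_self)
    have **: "cinner s x = 0" "cinner x s = 0" if "s \<in> P" for s
      using * that cinner_commute[of s x] by (auto simp: orthogonal_complement_def)
    have "x \<notin> P" using xx ** by fastforce
    have "orthonormal (insert x P)"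
      using P(2) ** xx \<open>x \<notin> P\<close> by (auto simp: orthonormal_def)
    with max[of "insert x P"] P x \<open>x \<notin> P\<close> show False by auto
  qed
  with P show thesis by (rule that)
qed

lemma residual_in_orthogonal_complement:
  assumes P: "orthonormal P" "finite P"
  shows "x - (\<Sum>s\<in>P. cinner x s *\<^sub>C s) \<in> orthogonal_complement P"
  using cinner_sum_orthonormal[OF P, of _ "cinner x"]
  by (auto simp: orthogonal_complement_def cinner.diff_left)

text \<open>The residual of the orthogonal expansion lies in \<open>U\<close> and is orthogonal to \<open>P\<close>; normalized, it would
  contradict maximality unless it is 0.\<close>

lemma expansion_of_maximal_orthonormal:
  assumes P: "orthonormal P" "finite P" "P \<subseteq> U" and U: "csubspace U"
    and max: "\<And>x. x \<in> U \<Longrightarrow> norm x = 1 \<Longrightarrow> x \<notin> orthogonal_complement P"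
    and x: "x \<in> U"
  shows "x = (\<Sum>s\<in>P. cinner x s *\<^sub>C s)"
proof (rule ccontr)
  assume ne: "x \<noteq> (\<Sum>s\<in>P. cinner x s *\<^sub>C s)"
  define r where "r = x - (\<Sum>s\<in>P. cinner x s *\<^sub>C s)"
  define y where "y = complex_of_real (1 / norm r) *\<^sub>C r"
  have "r \<in> U" unfolding r_def
    by (intro csubspace_diff csubspace_sum csubspace_scaleC U x) (use P in auto)
  then have "y \<in> U" by (simp add: y_def csubspace_scaleC U)
  moreover have "norm y = 1" using ne by (simp add: y_def norm_scaleC r_def norm_divide)
  moreover have "y \<in> orthogonal_complement P"
    unfolding y_def r_def
    by (intro csubspace_scaleC csubspace_orthogonal_complement
        residual_in_orthogonal_complement P)
  ultimately show False using max by blast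
qed

lemma cspan_maximal_orthonormal:
  assumes "orthonormal P" "finite P" "P \<subseteq> U" "csubspace U"
    and "\<And>x. x \<in> U \<Longrightarrow> norm x = 1 \<Longrightarrow> x \<notin> orthogonal_complement P"
  shows "cspan P = U"
proof
  show "cspan P \<subseteq> U" using complex_vector.span_minimal[OF assms(3,4)] .
  show "U \<subseteq> cspan P"
  proof
    fix x assume "x \<in> U"
    have "(\<Sum>s\<in>P. cinner x s *\<^sub>C s) \<in> cspan P"
      by (intro complex_vector.span_sum complex_vector.span_scale complex_vector.span_base)
    then show "x \<in> cspan P"
      using expansion_of_maximal_orthonormal[OF assms \<open>x \<in> U\<close>] by simp
  qed
qed

lemma orthonormal_basis_exists:
  assumes U: "csubspace U" and "ecdim U = enat d"
  obtains P where "orthonormal P" "finite P" "P \<subseteq> U" "card P = d"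
    "\<And>x. x \<in> U \<Longrightarrow> x = (\<Sum>s\<in>P. cinner x s *\<^sub>C s)"
proof -
  obtain B where B: "finite B" "U \<subseteq> cspan B"
    using assms(2) by (auto simp: ecdim_def split: if_splits)
  with assms(2) have d: "cdim U = d" by (auto simp: ecdim_def split: if_splits)
  obtain P where P: "P \<subseteq> U" "orthonormal P" 
    "\<And>x. x \<in> U \<Longrightarrow> norm x = 1 \<Longrightarrow> x \<notin> orthogonal_complement P"
    using maximal_orthonormal_subset by blast
  have ind: "\<not> complex_vector.dependent P" by (rule independent_orthonormal[OF P(2)])
  have fin: "finite P"
    using complex_vector.independent_span_bound[OF B(1) ind] B P by blast
  have "card P = d"
    using complex_vector.dim_span_eq_card_independent[OF ind]
      cspan_maximal_orthonormal[OF P(2) fin P(1) U P(3)] d by simp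
  with P fin show thesis
    using that expansion_of_maximal_orthonormal[OF P(2) fin P(1) U P(3)] by blast
qed

lemma ecdim_cspan_orthonormal:
  assumes "orthonormal P" "finite P"
  shows "ecdim (cspan P) = enat (card P)"
  using complex_vector.dim_span_eq_card_independent[OF independent_orthonormal[OF assms(1)]]
    assms(2) by (auto simp: ecdim_def)

text \<open>Distinct members of an orthonormal set have distance \<open>\<surd>2\<close>, so they cannot accumulate.\<close>

lemma finite_orthonormal_of_compact_closure:
  assumes P: "orthonormal P" and K: "compact (closure P)"
  shows "finite P"
proof (rule ccontr)
  assume "infinite P"
  then obtain x where "x islimpt P"
    using K closure_subset unfolding compact_eq_Bolzano_Weierstrass by blast
  then have "infinite (P \<inter> ball x (1/2))" by (simp add: islimpt_eq_infinite_ball)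
  then obtain p where p: "p \<in> P" "dist x p < 1/2"
    by (metis Int_iff finite.emptyI ex_in_conv mem_ball)
  from \<open>infinite (P \<inter> ball x (1/2))\<close> obtain q where "q \<in> P \<inter> ball x (1/2) - {p}"
    by (metis finite.emptyI ex_in_conv infinite_remove)
  then have q: "q \<in> P" "dist x q < 1/2" "q \<noteq> p" by auto
  have "(norm (p - 1 *\<^sub>C q))\<^sup>2 = 2"
    unfolding norm_sq_diff_scaleC
    using P p q orthonormal_norm[OF P p(1)] orthonormal_norm[OF P q(1)]
    by (auto simp: orthonormal_def)
  moreover have "norm (p - 1 *\<^sub>C q) < 1"
    using dist_triangle2[of p q x] p q by (simp add: scaleC_one dist_norm dist_commute norm_minus_commute)
  ultimately show False
    using power_le_one[of "norm (p - 1 *\<^sub>C q)" 2] by simp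
qed

text \<open>Closed boxes of coefficients serve as the Heine-Borel theorem for the span of \<open>P\<close>.\<close>

lemma compact_sum_scaled:
  assumes "finite P"
  shows "compact {(\<Sum>s\<in>P. c s *\<^sub>C (s :: 'a::complex_inner)) | c. \<forall>s\<in>P. cmod (c s) \<le> r}"
  using assms
proof (induction P rule: finite_induct)
  case empty
  then show ?case by simp
next
  case (insert x F)
  let ?K = "\<lambda>P. {(\<Sum>s\<in>P. c s *\<^sub>C s) | c. \<forall>s\<in>P. cmod (c s) \<le> r}"
  have "compact ((\<lambda>a. a *\<^sub>C x) ` cball 0 r)"
    by (intro compact_continuous_image scaleC.continuous_on continuous_intros compact_cball)
  then have "compact {a + b | a b. a \<in> (\<lambda>a. a *\<^sub>C x) ` cball 0 r \<and> b \<in> ?K F}"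
    using insert.IH compact_sums by blast
  moreover have "?K (insert x F) = {a + b | a b. a \<in> (\<lambda>a. a *\<^sub>C x) ` cball 0 r \<and> b \<in> ?K F}"
    (is "_ = ?R")
  proof
    show "?K (insert x F) \<subseteq> ?R" using insert.hyps by fastforce
    show "?R \<subseteq> ?K (insert x F)"
    proof
      fix y assume "y \<in> ?R"
      then obtain a c where *: "y = a *\<^sub>C x + (\<Sum>s\<in>F. c s *\<^sub>C s)" "cmod a \<le> r"
        "\<forall>s\<in>F. cmod (c s) \<le> r" by auto
      have "(\<Sum>s\<in>F. (c(x := a)) s *\<^sub>C s) = (\<Sum>s\<in>F. c s *\<^sub>C s)"
        using insert.hyps by (intro sum.cong) auto
      then show "y \<in> ?K (insert x F)"
        using * insert.hyps by (intro CollectI exI[of _ "c(x := a)"]) auto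
    qed
  qed
  ultimately show ?case by simp
qed

section \<open>Homogeneous linear systems\<close>

text \<open>Gaussian elimination of one equation at a time.\<close>

lemma homogeneous_system_solution:
  fixes M :: "'j \<Rightarrow> 's \<Rightarrow> 'f::field"
  assumes "finite J" "finite S" "card J < card S"
  shows "\<exists>c. (\<exists>s\<in>S. c s \<noteq> 0) \<and> (\<forall>j\<in>J. (\<Sum>s\<in>S. c s * M j s) = 0)"
  using assms
proof (induction J arbitrary: S M rule: finite_induct)
  case empty
  then have "S \<noteq> {}" by auto
  then show ?case by (intro exI[of _ "\<lambda>_. 1"]) auto
next
  case (insert j J)
  show ?case
  proof (cases "\<forall>s\<in>S. M j s = 0")
    case True
    have "card J < card S" using insert by simp
    from insert.IH[OF insert.prems(1) this, of M] obtain c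
      where "\<exists>s\<in>S. c s \<noteq> 0" "\<forall>j\<in>J. (\<Sum>s\<in>S. c s * M j s) = 0" by blast
    with True show ?thesis by (intro exI[of _ c]) simp
  next
    case False
    then obtain p where p: "p \<in> S" "M j p \<noteq> 0" by blast
    define T where "T = S - {p}"
    have T: "finite T" "card J < card T" "p \<notin> T" "S = insert p T"
      using insert p by (auto simp: T_def card_Diff_singleton)
    define N where "N = (\<lambda>k s. M k s - M k p * M j s / M j p)"
    from insert.IH[OF T(1,2), of N] obtain c
      where c: "\<exists>s\<in>T. c s \<noteq> 0" "\<forall>k\<in>J. (\<Sum>s\<in>T. c s * N k s) = 0" by blast
    define a where "a = - (\<Sum>s\<in>T. c s * M j s) / M j p"
    define c' where "c' = c(p := a)"
    have sum_eq: "(\<Sum>s\<in>S. c' s * M k s) = a * M k p + (\<Sum>s\<in>T. c s * M k s)" for k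
    proof -
      have "(\<Sum>s\<in>T. c' s * M k s) = (\<Sum>s\<in>T. c s * M k s)"
        using T(3) by (intro sum.cong) (auto simp: c'_def)
      then show ?thesis using T by (simp add: c'_def)
    qed
    have "(\<Sum>s\<in>S. c' s * M k s) = (\<Sum>s\<in>T. c s * N k s)" for k
      unfolding sum_eq N_def a_def
      by (simp add: right_diff_distrib sum_subtractf sum_distrib_left sum_divide_distrib
          sum_negf mult_ac)
    moreover have "(\<Sum>s\<in>T. c s * N j s) = 0"
      using p by (simp add: N_def)
    ultimately have "\<forall>k\<in>insert j J. (\<Sum>s\<in>S. c' s * M k s) = 0" using c(2) by simp
    moreover have "\<exists>s\<in>S. c' s \<noteq> 0" using c(1) T by (auto simp: c'_def)
    ultimately show ?thesis by blast
  qed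
qed

section \<open>Self-adjoint operators\<close>

lemma adjoint_op_eqI:
  assumes A: "densely_defined A" and w: "\<And>u. u \<in> dom A \<Longrightarrow> cinner (the (A u)) v = cinner u w"
  shows "adjoint_op A v = Some w"
proof -
  have "x = w" if x: "\<forall>u\<in>dom A. cinner (the (A u)) v = cinner u x" for x
  proof -
    have "cinner u (x - w) = 0" if "u \<in> dom A" for u
      using x w[OF that] that by (simp add: cinner.diff_right)
    with A have "x - w = 0" unfolding densely_defined_def by (rule dense_cinner_eq_0)
    then show ?thesis by simp
  qed
  then have "(THE w. \<forall>u\<in>dom A. cinner (the (A u)) v = cinner u w) = w"
    using w by (intro the_equality) auto
  then show ?thesis using w unfolding adjoint_op_def by auto
qed

lemma adjoint_opD:
  assumes A: "densely_defined A" and v: "adjoint_op A v = Some w" and u: "u \<in> dom A"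
  shows "cinner (the (A u)) v = cinner u w"
proof -
  from v obtain x where x: "\<forall>u\<in>dom A. cinner (the (A u)) v = cinner u x"
    by (auto simp: adjoint_op_def split: if_splits)
  with adjoint_op_eqI[OF A, of v x] v have "x = w" by auto
  with x u show ?thesis by blast
qed

lemma dom_shift_op: "dom (shift_op B z) = dom B"
  by (auto simp: shift_op_def dom_def)

lemma the_shift_op: "u \<in> dom B \<Longrightarrow> the (shift_op B z u) = the (B u) - z *\<^sub>C u"
  by (auto simp: shift_op_def)

lemma ker_shift_op: "ker_op (shift_op B z) = {u \<in> dom B. the (B u) = z *\<^sub>C u}"
  by (simp add: ker_op_def dom_shift_op the_shift_op cong: conj_cong)

locale selfadjoint_operator =
  fixes B :: "'a::chilbert_space \<rightharpoonup> 'a"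
  assumes selfadjoint: "selfadjoint_op B"
begin

abbreviation app :: "'a \<Rightarrow> 'a" where "app u \<equiv> the (B u)"

lemma subspace_dom: "csubspace (dom B)"
  using selfadjoint by (simp add: selfadjoint_op_def linear_op_def)

lemmas dom_simps = csubspace_0[OF subspace_dom] csubspace_add[OF subspace_dom]
  csubspace_diff[OF subspace_dom] csubspace_scaleC[OF subspace_dom] csubspace_sum[OF subspace_dom]

lemma app_add: "u \<in> dom B \<Longrightarrow> v \<in> dom B \<Longrightarrow> app (u + v) = app u + app v"
  using selfadjoint by (simp add: selfadjoint_op_def linear_op_def)

lemma app_scaleC: "u \<in> dom B \<Longrightarrow> app (c *\<^sub>C u) = c *\<^sub>C app u"
  using selfadjoint by (simp add: selfadjoint_op_def linear_op_def)

lemma app_0: "app 0 = 0"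
  using app_scaleC[OF dom_simps(1), of 0] by simp

lemma app_diff: "u \<in> dom B \<Longrightarrow> v \<in> dom B \<Longrightarrow> app (u - v) = app u - app v"
  using app_add[of "u - v" v] dom_simps(3)[of u v] by (simp add: algebra_simps)

lemma app_sum: "(\<And>i. i \<in> I \<Longrightarrow> f i \<in> dom B) \<Longrightarrow> app (sum f I) = (\<Sum>i\<in>I. app (f i))"
proof (induction I rule: infinite_finite_induct)
  case (insert x F)
  have x: "f x \<in> dom B" by (rule insert.prems) simp
  have F: "f i \<in> dom B" if "i \<in> F" for i by (rule insert.prems) (simp add: that)
  have "sum f F \<in> dom B" using F by (rule dom_simps)
  from app_add[OF x this] insert.IH[OF F] insert.hyps show ?case by simp
qed (simp_all add: app_0)

lemma app_combination:
  assumes f: "\<And>s. s \<in> S \<Longrightarrow> f s \<in> dom B"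
  shows "(\<Sum>s\<in>S. c s *\<^sub>C f s) \<in> dom B" "app (\<Sum>s\<in>S. c s *\<^sub>C f s) = (\<Sum>s\<in>S. c s *\<^sub>C app (f s))"
proof -
  have *: "c s *\<^sub>C f s \<in> dom B" if "s \<in> S" for s using f[OF that] by (rule dom_simps)
  then show "(\<Sum>s\<in>S. c s *\<^sub>C f s) \<in> dom B" by (rule dom_simps)
  have "app (\<Sum>s\<in>S. c s *\<^sub>C f s) = (\<Sum>s\<in>S. app (c s *\<^sub>C f s))" using * by (rule app_sum)
  also have "\<dots> = (\<Sum>s\<in>S. c s *\<^sub>C app (f s))" by (intro sum.cong refl app_scaleC f)
  finally show "app (\<Sum>s\<in>S. c s *\<^sub>C f s) = (\<Sum>s\<in>S. c s *\<^sub>C app (f s))" .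
qed

lemma densely_defined: "densely_defined B" and adjoint: "adjoint_op B = B"
  using selfadjoint by (simp_all add: selfadjoint_op_def)

lemma symmetric:
  assumes "u \<in> dom B" "v \<in> dom B"
  shows "cinner (app u) v = cinner u (app v)"
  using assms(2) by (intro adjoint_opD[OF densely_defined _ assms(1)]) (auto simp: adjoint)

text \<open>This is the inclusion of the domain of the adjoint in the domain of \<open>B\<close>. Every membership in the domain
  that does not come from linearity comes from here: limits in the graph, and vectors orthogonal to
  a range.\<close>

lemma in_domI:
  assumes "\<And>u. u \<in> dom B \<Longrightarrow> cinner (app u) v = cinner u w"
  shows "v \<in> dom B" "app v = w"
  using adjoint_op_eqI[OF densely_defined assms] by (auto simp: adjoint)

lemma closed_graph:
  assumes u: "\<And>n. u n \<in> dom B" "u \<longlonglongrightarrow> x" "(\<lambda>n. app (u n)) \<longlonglongrightarrow> y"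
  shows "x \<in> dom B" "app x = y"
proof -
  have *: "cinner (app v) x = cinner v y" if v: "v \<in> dom B" for v
  proof (rule LIMSEQ_unique)
    show "(\<lambda>n. cinner (app v) (u n)) \<longlonglongrightarrow> cinner (app v) x"
      by (intro cinner.tendsto tendsto_const u)
    have "(\<lambda>n. cinner v (app (u n))) \<longlonglongrightarrow> cinner v y"
      by (intro cinner.tendsto tendsto_const u)
    then show "(\<lambda>n. cinner (app v) (u n)) \<longlonglongrightarrow> cinner v y"
      by (simp add: symmetric v u)
  qed
  show "x \<in> dom B" using * by (rule in_domI)
  show "app x = y" using * by (rule in_domI)
qed

lemma eigenvalue_real:
  assumes "u \<in> dom B" "app u = z *\<^sub>C u" "u \<noteq> 0"
  shows "z = complex_of_real (Re z)"
proof -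
  have "z * cinner u u = cnj z * cinner u u"
    using symmetric[OF assms(1,1)] assms(2)
    by (simp add: cinner_scaleC_left cinner_scaleC_right)
  with assms(3) have "z = cnj z" by (simp add: cinner_self)
  then show ?thesis by (simp add: complex_eq_iff)
qed

lemma eigenvectors_orthogonal:
  assumes "u \<in> dom B" "app u = complex_of_real a *\<^sub>C u" "v \<in> dom B" "app v = complex_of_real b *\<^sub>C v"
    and "a \<noteq> b"
  shows "cinner u v = 0"
  using symmetric[OF assms(1,3)] assms by (simp add: cinner_scaleC_left cinner_scaleC_right)

lemma subspace_eigenspace: "csubspace {u \<in> dom B. app u = z *\<^sub>C u}"
  by (rule complex_vector.subspaceI)
    (auto simp: dom_simps app_0 app_add app_scaleC scaleC_add_right scaleC_scaleC mult.commute)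

text \<open>The mixed term vanishes since \<open>\<langle>B u, u\<rangle>\<close> is real. Consequently the graph norm of \<open>u\<close> is the norm of \<open>(B - \<i>) u\<close>,
  and \<open>B - \<i>\<close> is bounded below by 1.\<close>

lemma norm_app_minus_i:
  assumes "u \<in> dom B"
  shows "(norm (app u - \<i> *\<^sub>C u))\<^sup>2 = (norm (app u))\<^sup>2 + (norm u)\<^sup>2"
proof -
  have "cinner (app u) u = cnj (cinner (app u) u)"
    using symmetric[OF assms assms] cinner_commute[of "app u" u] by simp
  then have "Im (cinner (app u) u) = 0" by (simp add: complex_eq_iff)
  then show ?thesis by (simp add: norm_sq_diff_scaleC)
qed

text \<open>The complement of a set of eigenvectors reduces \<open>B\<close>, so that the part of \<open>B\<close> in it can be treated like
  \<open>B\<close> itself.\<close>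

lemma app_in_orthogonal_complement:
  assumes "P \<subseteq> dom B" "\<And>p. p \<in> P \<Longrightarrow> \<exists>a. app p = a *\<^sub>C p"
    and "u \<in> orthogonal_complement P" "u \<in> dom B"
  shows "app u \<in> orthogonal_complement P"
proof -
  have "cinner (app u) p = 0" if "p \<in> P" for p
  proof -
    from that assms obtain a where "app p = a *\<^sub>C p" by blast
    with that assms show ?thesis
      using symmetric[of u p] by (auto simp: cinner_scaleC_right orthogonal_complement_def)
  qed
  then show ?thesis by (simp add: orthogonal_complement_def)
qed

text \<open>The lower bound makes the range of \<open>B - z\<close> on the complement \<open>V\<close> of \<open>P\<close> closed. A vector \<open>h\<close> of \<open>V\<close>
  orthogonal to this range is orthogonal to the whole range of \<open>B - z\<close>, because \<open>P\<close> spans an invariant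
  subspace to which \<open>h\<close> is orthogonal anyway; self-adjointness then makes \<open>h\<close> an eigenvector for the
  conjugate of \<open>z\<close>, so \<open>h = 0\<close> and the range is all of \<open>V\<close>.\<close>

lemma solve_on_complement:
  assumes P: "orthonormal P" "finite P" "P \<subseteq> dom B" "\<And>p. p \<in> P \<Longrightarrow> \<exists>a. app p = a *\<^sub>C p"
    and c: "c > 0" "\<And>u. u \<in> orthogonal_complement P \<Longrightarrow> u \<in> dom B \<Longrightarrow>
      c * norm u \<le> norm (app u - z *\<^sub>C u)"
    and inj: "\<And>u. u \<in> orthogonal_complement P \<Longrightarrow> u \<in> dom B \<Longrightarrow> app u = cnj z *\<^sub>C u \<Longrightarrow> u = 0"
    and f: "f \<in> orthogonal_complement P"
  obtains u where "u \<in> orthogonal_complement P" "u \<in> dom B" "app u - z *\<^sub>C u = f"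
proof -
  let ?V = "orthogonal_complement P"
  let ?T = "\<lambda>u. app u - z *\<^sub>C u"
  define R where "R = ?T ` (?V \<inter> dom B)"
  note V = csubspace_simps[OF csubspace_orthogonal_complement[of P]]
  have T_diff: "?T (u - v) = ?T u - ?T v" if "u \<in> dom B" "v \<in> dom B" for u v
    using that by (simp add: app_diff scaleC.diff_right)
  have "csubspace R"
  proof (rule complex_vector.subspaceI)
    show "0 \<in> R" unfolding R_def
      by (rule image_eqI[of _ _ 0]) (simp_all add: app_0 V dom_simps)
  next
    fix x y assume "x \<in> R" "y \<in> R"
    then obtain u v where "u \<in> ?V \<inter> dom B" "v \<in> ?V \<inter> dom B" "x = ?T u" "y = ?T v"
      unfolding R_def by blast
    then show "x + y \<in> R" unfolding R_def
      by (intro image_eqI[of _ _ "u + v"]) (auto simp: app_add scaleC_add_right V dom_simps)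
  next
    fix a x assume "x \<in> R"
    then obtain u where "u \<in> ?V \<inter> dom B" "x = ?T u"
      unfolding R_def by blast
    then show "a *\<^sub>C x \<in> R" unfolding R_def
      by (intro image_eqI[of _ _ "a *\<^sub>C u"])
        (auto simp: app_scaleC scaleC.diff_right scaleC_scaleC mult.commute V dom_simps)
  qed
  have "closed R"
    unfolding closed_sequential_limits
  proof (intro allI impI)
    fix g y assume g: "(\<forall>n. g n \<in> R) \<and> g \<longlonglongrightarrow> y"
    then obtain u where u: "\<And>n. u n \<in> ?V" "\<And>n. u n \<in> dom B" "\<And>n. ?T (u n) = g n"
      unfolding R_def image_iff by (metis IntE)
    have "Cauchy u"
    proof (rule metric_CauchyI)
      fix e :: real assume "e > 0"
      then have "c * e > 0" using c by simp
      then obtain M where M: "\<And>m n. m \<ge> M \<Longrightarrow> n \<ge> M \<Longrightarrow> dist (g m) (g n) < c * e"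
        using metric_CauchyD[OF LIMSEQ_imp_Cauchy[OF conjunct2[OF g]]] by blast
      have "dist (u m) (u n) < e" if "m \<ge> M" "n \<ge> M" for m n
      proof -
        have "c * norm (u m - u n) \<le> norm (g m - g n)"
          using c(2)[of "u m - u n"] by (simp add: T_diff u V dom_simps)
        with M[OF that] have "c * norm (u m - u n) < c * e" by (simp add: dist_norm)
        with c(1) show ?thesis by (simp add: dist_norm)
      qed
      then show "\<exists>M. \<forall>m\<ge>M. \<forall>n\<ge>M. dist (u m) (u n) < e" by blast
    qed
    then obtain x where x: "u \<longlonglongrightarrow> x" using Cauchy_convergent convergent_def by blast
    have "(\<lambda>n. g n + z *\<^sub>C u n) \<longlonglongrightarrow> y + z *\<^sub>C x"
      using g by (intro tendsto_add scaleC.tendsto tendsto_const x) auto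
    moreover have "g n + z *\<^sub>C u n = app (u n)" for n using u(3)[of n] by (simp add: algebra_simps)
    ultimately have "(\<lambda>n. app (u n)) \<longlonglongrightarrow> y + z *\<^sub>C x" by simp
    from closed_graph[OF u(2) x this] have "x \<in> dom B" "y = ?T x" by simp_all
    moreover have "x \<in> ?V"
      using closed_sequentially[OF closed_orthogonal_complement u(1) x] .
    ultimately show "y \<in> R" unfolding R_def by blast
  qed
  have R_V: "R \<subseteq> ?V"
    unfolding R_def
    by (rule image_subsetI) (simp add: V app_in_orthogonal_complement[OF P(3,4)])
  obtain g where g: "g \<in> R" "f - g \<in> orthogonal_complement R"
    using orthogonal_projection_exists[OF \<open>csubspace R\<close> \<open>closed R\<close>] by blast
  define h where "h = f - g"
  have "h \<in> ?V" using f g R_V by (auto simp: h_def V)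
  have "cinner (app v) h = cinner v (cnj z *\<^sub>C h)" if v: "v \<in> dom B" for v
  proof -
    define w where "w = (\<Sum>s\<in>P. cinner v s *\<^sub>C s)"
    have w: "w \<in> dom B" "app w = (\<Sum>s\<in>P. cinner v s *\<^sub>C app s)"
      unfolding w_def by (rule app_combination[of P "\<lambda>s. s", OF subsetD[OF P(3)]], assumption)+
    have "v - w \<in> ?V" unfolding w_def by (rule residual_in_orthogonal_complement[OF P(1,2)])
    then have "?T (v - w) \<in> R" using v w by (auto simp: R_def dom_simps)
    then have "cinner (?T (v - w)) h = 0"
      using g cinner_commute[of "?T (v - w)" h] by (simp add: h_def orthogonal_complement_def)
    moreover have "cinner (?T w) h = 0"
    proof -
      have sh: "cinner s h = 0" if "s \<in> P" for s
        using \<open>h \<in> ?V\<close> that cinner_commute[of s h] by (simp add: orthogonal_complement_def)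
      moreover have "cinner (app s) h = 0" if "s \<in> P" for s
        using P(4)[OF that] sh[OF that] by (auto simp: cinner_scaleC_left)
      ultimately show ?thesis
        unfolding w(2) by (simp add: w_def cinner.diff_left cinner.sum_left cinner_scaleC_left)
    qed
    ultimately have "cinner (?T v) h = 0"
      unfolding T_diff[OF v w(1)] by (simp add: cinner.diff_left)
    then show ?thesis by (simp add: cinner.diff_left cinner_scaleC_left cinner_scaleC_right)
  qed
  from in_domI[OF this] inj \<open>h \<in> ?V\<close> have "h = 0" by blast
  then have "f \<in> R" using g by (simp add: h_def)
  then show thesis using that unfolding R_def by blast
qed

lemma solve:
  assumes c: "c > 0" "\<And>u. u \<in> dom B \<Longrightarrow> c * norm u \<le> norm (app u - z *\<^sub>C u)"
    and inj: "\<And>u. u \<in> dom B \<Longrightarrow> app u = cnj z *\<^sub>C u \<Longrightarrow> u = 0"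
  obtains u where "u \<in> dom B" "app u - z *\<^sub>C u = f"
proof (rule solve_on_complement[of "{}" c z f])
  show "orthonormal {}" "f \<in> orthogonal_complement {}"
    by (simp_all add: orthonormal_def orthogonal_complement_def)
qed (use c inj that in auto)

lemma range_minus_i:
  obtains u where "u \<in> dom B" "app u - \<i> *\<^sub>C u = f"
proof -
  have "1 * norm u \<le> norm (app u - \<i> *\<^sub>C u)" if "u \<in> dom B" for u
    using norm_app_minus_i[OF that] power2_le_imp_le[of "norm u" "norm (app u - \<i> *\<^sub>C u)"] by simp
  moreover have "u = 0" if "u \<in> dom B" "app u = cnj \<i> *\<^sub>C u" for u
    using eigenvalue_real[OF that] by (auto simp: complex_eq_iff)
  ultimately show thesis
    using solve[of 1 \<i> f] that by (metis zero_less_one)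
qed

end

section \<open>Compact resolvent\<close>

context selfadjoint_operator
begin

text \<open>Unit vectors \<open>u\<^sub>n\<close> of \<open>M\<close> with \<open>(B - z) u\<^sub>n\<close> tending to 0 are bounded in the graph norm, so a subsequence
  converges; as the graph is closed, its limit would be an eigenvector in \<open>M\<close>.\<close>

lemma lower_bound_of_injective:
  assumes cr: "compact_resolvent B" and M: "csubspace M" "closed M"
    and inj: "\<And>u. u \<in> M \<Longrightarrow> u \<in> dom B \<Longrightarrow> app u = z *\<^sub>C u \<Longrightarrow> u = 0"
  obtains c where "c > 0" "\<And>u. u \<in> M \<Longrightarrow> u \<in> dom B \<Longrightarrow> c * norm u \<le> norm (app u - z *\<^sub>C u)"
proof (rule ccontr)
  assume no: "\<not> thesis"
  have "\<exists>u. u \<in> M \<and> u \<in> dom B \<and> norm u = 1 \<and> norm (app u - z *\<^sub>C u) < 1 / real (Suc n)" for n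
  proof -
    from no that[of "1 / real (Suc n)"] obtain v
      where v: "v \<in> M" "v \<in> dom B" "norm (app v - z *\<^sub>C v) < 1 / real (Suc n) * norm v"
      by (metis not_le of_nat_0_less_iff zero_less_Suc zero_less_divide_1_iff)
    then have "norm v > 0" by (auto simp: app_0)
    define a where "a = complex_of_real (1 / norm v)"
    have "app (a *\<^sub>C v) - z *\<^sub>C (a *\<^sub>C v) = a *\<^sub>C (app v - z *\<^sub>C v)"
      using v by (simp add: app_scaleC scaleC.diff_right scaleC_scaleC mult.commute)
    then have "norm (app (a *\<^sub>C v) - z *\<^sub>C (a *\<^sub>C v)) < 1 / real (Suc n)"
      using v(3) \<open>norm v > 0\<close> by (simp only: norm_scaleC) (simp add: a_def norm_divide field_simps)
    moreover have "norm (a *\<^sub>C v) = 1"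
      using \<open>norm v > 0\<close> by (simp add: norm_scaleC a_def norm_divide)
    ultimately show ?thesis using v csubspace_scaleC[OF M(1)] dom_simps(4) by blast
  qed
  then obtain u where u: "\<And>n. u n \<in> M" "\<And>n. u n \<in> dom B" "\<And>n. norm (u n) = 1"
    "\<And>n. norm (app (u n) - z *\<^sub>C u n) < 1 / real (Suc n)" by metis
  have "graph_norm B (u n) \<le> 2 + cmod z" for n
  proof -
    have "norm (app (u n)) \<le> norm (app (u n) - z *\<^sub>C u n) + norm (z *\<^sub>C u n)"
      using norm_triangle_ineq[of "app (u n) - z *\<^sub>C u n" "z *\<^sub>C u n"] by simp
    also have "\<dots> \<le> 1 + cmod z"
    proof -
      have "1 / real (Suc n) \<le> 1" by simp
      then have "norm (app (u n) - z *\<^sub>C u n) \<le> 1" using u(4)[of n] by linarith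
      then show ?thesis using u(3)[of n] by (simp add: norm_scaleC)
    qed
    finally show ?thesis
      using sqrt_sum_squares_le_sum[of "norm (u n)" "norm (app (u n))"] u(3)[of n]
      by (simp add: graph_norm_def)
  qed
  then have "compact (closure (range u))"
    using cr[unfolded compact_resolvent_def, rule_format, of "range u"] u(2) by blast
  moreover have "\<forall>n. u n \<in> closure (range u)" by (intro allI subsetD[OF closure_subset] rangeI)
  ultimately have "\<exists>x\<in>closure (range u). \<exists>r :: nat \<Rightarrow> nat. strict_mono r \<and> (u \<circ> r) \<longlonglongrightarrow> x"
    by (simp add: compact_def)
  then obtain x and r :: "nat \<Rightarrow> nat" where r: "strict_mono r" and x: "(u \<circ> r) \<longlonglongrightarrow> x"
    by blast
  have "(\<lambda>n. app (u n) - z *\<^sub>C u n) \<longlonglongrightarrow> 0"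
  proof (rule Lim_null_comparison)
    show "(\<lambda>n. 1 / real (Suc n)) \<longlonglongrightarrow> 0" using lim_inverse_n'[THEN LIMSEQ_Suc] .
    show "\<forall>\<^sub>F n in sequentially. norm (app (u n) - z *\<^sub>C u n) \<le> 1 / real (Suc n)"
      using u(4) less_imp_le by (intro always_eventually) blast
  qed
  from LIMSEQ_subseq_LIMSEQ[OF this r]
  have "(\<lambda>n. (app (u (r n)) - z *\<^sub>C u (r n)) + z *\<^sub>C u (r n)) \<longlonglongrightarrow> 0 + z *\<^sub>C x"
    using x by (intro tendsto_add scaleC.tendsto tendsto_const) (simp_all add: o_def)
  then have "(\<lambda>n. app ((u \<circ> r) n)) \<longlonglongrightarrow> z *\<^sub>C x" by simp
  from closed_graph[OF _ x this] u(2) have "x \<in> dom B" "app x = z *\<^sub>C x" by simp_all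
  moreover have "x \<in> M" using closed_sequentially[OF M(2) _ x] u(1) by simp
  ultimately have "x = 0" using inj by blast
  moreover have "norm x = 1"
    using tendsto_norm[OF x] u(3) by (simp add: o_def LIMSEQ_const_iff)
  ultimately show False by simp
qed

text \<open>Away from the eigenvalues, compactness provides the lower bound for \<open>B - z\<close>, and the lower bound
  provides surjectivity.\<close>

lemma spectrum_eq_eigenvalues:
  assumes cr: "compact_resolvent B"
  shows "spectrum_op B = complex_of_real ` {\<mu>. \<exists>u\<in>dom B. u \<noteq> 0 \<and> app u = complex_of_real \<mu> *\<^sub>C u}"
proof -
  have res: "z \<in> resolvent_set_op B \<longleftrightarrow> (\<forall>u\<in>dom B. app u = z *\<^sub>C u \<longrightarrow> u = 0)" for z
  proof
    assume "z \<in> resolvent_set_op B"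
    then have inj: "inj_on (\<lambda>u. the (shift_op B z u)) (dom B)"
      by (auto simp: resolvent_set_op_def bij_betw_def)
    show "\<forall>u\<in>dom B. app u = z *\<^sub>C u \<longrightarrow> u = 0"
      using inj_onD[OF inj _ _ dom_simps(1)] by (auto simp: the_shift_op dom_simps app_0)
  next
    assume inj: "\<forall>u\<in>dom B. app u = z *\<^sub>C u \<longrightarrow> u = 0"
    obtain c where c: "c > 0" "\<And>u. u \<in> dom B \<Longrightarrow> c * norm u \<le> norm (app u - z *\<^sub>C u)"
      using lower_bound_of_injective[OF cr complex_vector.subspace_UNIV closed_UNIV, of z] inj by auto
    have "u = 0" if "u \<in> dom B" "app u = cnj z *\<^sub>C u" for u
    proof (rule ccontr)
      assume "u \<noteq> 0"
      then have "z = cnj z" using eigenvalue_real[OF that] by (simp add: complex_eq_iff)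
      with that inj \<open>u \<noteq> 0\<close> show False by auto
    qed
    then have surj: "\<exists>u\<in>dom B. app u - z *\<^sub>C u = f" for f
      using solve[of c z f] c by metis
    have "bij_betw (\<lambda>u. the (shift_op B z u)) (dom B) UNIV"
      unfolding bij_betw_def
    proof
      show "inj_on (\<lambda>u. the (shift_op B z u)) (dom B)"
      proof (rule inj_onI)
        fix u v assume *: "u \<in> dom B" "v \<in> dom B" "the (shift_op B z u) = the (shift_op B z v)"
        then have "app (u - v) = z *\<^sub>C (u - v)"
          by (simp add: the_shift_op app_diff scaleC.diff_right algebra_simps)
        with inj * have "u - v = 0" using dom_simps(3) by blast
        then show "u = v" by simp
      qed
      show "(\<lambda>u. the (shift_op B z u)) ` dom B = UNIV"
        using surj by (auto simp: image_iff) (metis the_shift_op)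
    qed
    moreover have "norm u \<le> 1 / c * norm (the (shift_op B z u))" if "u \<in> dom B" for u
      using c(1) c(2)[OF that] that by (simp add: the_shift_op field_simps)
    ultimately show "z \<in> resolvent_set_op B" unfolding resolvent_set_op_def by blast
  qed
  show ?thesis
  proof (intro set_eqI iffI)
    fix z assume "z \<in> spectrum_op B"
    then obtain u where "u \<in> dom B" "app u = z *\<^sub>C u" "u \<noteq> 0"
      using res by (auto simp: spectrum_op_def)
    then show "z \<in> complex_of_real ` {\<mu>. \<exists>u\<in>dom B. u \<noteq> 0 \<and> app u = complex_of_real \<mu> *\<^sub>C u}"
      using eigenvalue_real[of u z] by (intro image_eqI[of _ _ "Re z"]) auto
  next
    fix z assume "z \<in> complex_of_real ` {\<mu>. \<exists>u\<in>dom B. u \<noteq> 0 \<and> app u = complex_of_real \<mu> *\<^sub>C u}"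
    then show "z \<in> spectrum_op B" using res by (auto simp: spectrum_op_def)
  qed
qed

text \<open>For unit eigenvectors a bound on the eigenvalues bounds the graph norm, and an orthonormal set with
  compact closure is finite.\<close>

lemma finite_orthonormal_eigenvectors:
  assumes cr: "compact_resolvent B" and P: "orthonormal P" "P \<subseteq> dom B"
    and r: "\<And>p. p \<in> P \<Longrightarrow> \<exists>a. app p = a *\<^sub>C p \<and> cmod a \<le> r"
  shows "finite P"
proof -
  have "graph_norm B p \<le> 1 + r" if "p \<in> P" for p
  proof -
    from r[OF that] obtain a where "app p = a *\<^sub>C p" "cmod a \<le> r" by blast
    then show ?thesis
      using sqrt_sum_squares_le_sum[of "norm p" "norm (app p)"] orthonormal_norm[OF P(1) that]
      by (simp add: graph_norm_def norm_scaleC)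
  qed
  then have "compact (closure P)"
    using cr[unfolded compact_resolvent_def, rule_format, of P] P(2) by blast
  with P(1) show ?thesis by (rule finite_orthonormal_of_compact_closure)
qed

text \<open>The infimum \<open>m\<close> of the quotient \<open>\<langle>B u, u\<rangle> / \<parallel>u\<parallel>\<^sup>2\<close> over the complement of \<open>P\<close> belongs to the spectrum there:
  if \<open>c \<parallel>u\<parallel> \<le> \<parallel>(B - m) u\<parallel>\<close>, evaluating the nonnegative form of \<open>B - m\<close> at \<open>u - c (B - m)\<^sup>-\<^sup>1 u\<close>
  yields \<open>\<langle>(B - m) u, u\<rangle> \<ge> c\<close> for all unit vectors, and \<open>m\<close> would not be the infimum. As the
  spectrum consists of eigenvalues, \<open>m\<close> exceeds \<open>E\<close> once the eigenvectors up to \<open>E\<close> are split off.\<close>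

lemma form_gt_on_complement:
  assumes cr: "compact_resolvent B"
    and C: "\<And>u. u \<in> dom B \<Longrightarrow> C * (norm u)\<^sup>2 \<le> Re (cinner (app u) u)"
    and P: "orthonormal P" "finite P" "P \<subseteq> dom B" "\<And>p. p \<in> P \<Longrightarrow> \<exists>a. app p = a *\<^sub>C p"
    and no: "\<And>\<mu> u. \<mu> \<le> E \<Longrightarrow> u \<in> orthogonal_complement P \<Longrightarrow> u \<in> dom B \<Longrightarrow>
      app u = complex_of_real \<mu> *\<^sub>C u \<Longrightarrow> u = 0"
    and u: "u \<in> orthogonal_complement P" "u \<in> dom B" "u \<noteq> 0"
  shows "E * (norm u)\<^sup>2 < Re (cinner (app u) u)"
proof (rule ccontr)
  assume "\<not> E * (norm u)\<^sup>2 < Re (cinner (app u) u)"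
  then have neg: "Re (cinner (app u) u) \<le> E * (norm u)\<^sup>2" by simp
  let ?V = "orthogonal_complement P"
  note V = csubspace_simps[OF csubspace_orthogonal_complement[of P]]
  define X where "X = {Re (cinner (app v) v) | v. v \<in> ?V \<and> v \<in> dom B \<and> norm v = 1}"
  define m where "m = Inf X"
  have normalize: "Re (cinner (app w) w) / (norm w)\<^sup>2 \<in> X"
    if w: "w \<in> ?V" "w \<in> dom B" "w \<noteq> 0" for w
  proof -
    define y where "y = complex_of_real (1 / norm w) *\<^sub>C w"
    have "y \<in> ?V" "y \<in> dom B" using w by (simp_all add: y_def V dom_simps)
    moreover have "norm y = 1" using w by (simp add: y_def norm_scaleC norm_divide)
    moreover have "Re (cinner (app y) y) = Re (cinner (app w) w) / (norm w)\<^sup>2"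
    proof -
      have "cinner (app y) y = complex_of_real (1 / (norm w)\<^sup>2) * cinner (app w) w"
        using w(2) by (simp add: y_def app_scaleC cinner_scaleC_left cinner_scaleC_right
            power2_eq_square)
      moreover have "Re (complex_of_real r * c) = r * Re c" for r c by simp
      ultimately show ?thesis by simp
    qed
    ultimately show ?thesis unfolding X_def by (intro CollectI exI[of _ y]) auto
  qed
  have bdd: "bdd_below X"
    using C by (intro bdd_belowI[of _ C]) (fastforce simp: X_def)
  have m_le: "m * (norm w)\<^sup>2 \<le> Re (cinner (app w) w)" if "w \<in> ?V" "w \<in> dom B" for w
  proof (cases "w = 0")
    case False
    from cInf_lower[OF normalize[OF that False] bdd] False show ?thesis
      by (simp add: m_def field_simps)
  qed (simp add: cinner.zero_right)
  have "m \<le> E"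
    using m_le[OF u(1,2)] neg u(3) by (meson order_trans mult_le_cancel_right_pos zero_less_norm_iff zero_less_power)
  then have inj: "\<And>v. v \<in> ?V \<Longrightarrow> v \<in> dom B \<Longrightarrow> app v = complex_of_real m *\<^sub>C v \<Longrightarrow> v = 0"
    using no by blast
  obtain c where c: "c > 0" "\<And>v. v \<in> ?V \<Longrightarrow> v \<in> dom B \<Longrightarrow>
      c * norm v \<le> norm (app v - complex_of_real m *\<^sub>C v)"
    using lower_bound_of_injective[OF cr csubspace_orthogonal_complement
        closed_orthogonal_complement inj] by blast
  have "m + c \<le> Re (cinner (app v) v)" if v: "v \<in> ?V" "v \<in> dom B" "norm v = 1" for v
  proof -
    obtain w where w: "w \<in> ?V" "w \<in> dom B" "app w - complex_of_real m *\<^sub>C w = v"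
      using solve_on_complement[OF P c _ v(1)] inj by (metis complex_cnj_complex_of_real)
    \<comment> \<open>\<open>c\<close> minimizes the bound \<open>q(v) - 2 t + t\<^sup>2 / c\<close> for the form \<open>q\<close> of \<open>B - m\<close> at \<open>v - t w\<close>\<close>
    define x where "x = v - complex_of_real c *\<^sub>C w"
    have x: "x \<in> ?V" "x \<in> dom B" using v w by (simp_all add: x_def V dom_simps)
    have vw: "cinner (app v) w = cinner v v + complex_of_real m * cinner v w"
      using symmetric[OF v(2) w(2)] w(3)
      by (metis cinner.add_right cinner_scaleC_right complex_cnj_complex_of_real diff_add_cancel)
    have "app w = v + complex_of_real m *\<^sub>C w" using w(3) by (simp add: algebra_simps)
    then have app_x: "app x = app v - complex_of_real c *\<^sub>C (v + complex_of_real m *\<^sub>C w)"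
      using v w by (simp add: x_def app_diff app_scaleC dom_simps)
    have "c * norm w \<le> 1" using c(2)[OF w(1,2)] w(3) v(3) by simp
    have "Re (cinner v w) \<le> norm w"
      using norm_cinner_le[of v w] complex_Re_le_cmod[of "cinner v w"] v(3) by simp
    then have "c * Re (cinner v w) \<le> 1"
      using \<open>c * norm w \<le> 1\<close> c(1) by (meson mult_left_mono less_imp_le order_trans)
    then have "c * (c * Re (cinner v w)) \<le> c * 1"
      using c(1) by (intro mult_left_mono) auto
    moreover have "0 \<le> Re (cinner (app x) x) - m * Re (cinner x x)"
      using m_le[OF x] by (simp add: Re_cinner_self)
    moreover have "Re (cinner (app x) x) - m * Re (cinner x x)
        = Re (cinner (app v) v) - m - 2 * c + c * (c * Re (cinner v w))"
      unfolding app_x using Re_cinner_self[of v] Re_cinner_commute[of w v] v(3)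
      by (simp add: x_def cinner.diff_left cinner.diff_right cinner.add_left
          cinner_scaleC_left cinner_scaleC_right vw algebra_simps)
    ultimately show ?thesis by simp
  qed
  then have "m + c \<le> m"
    unfolding m_def using normalize[OF u] by (intro cInf_greatest) (auto simp: X_def)
  with c(1) show False by simp
qed

end

section \<open>Counting eigenvalues\<close>

text \<open>
  The enumeration is the generalized inverse of \<open>c E = card {s \<in> S. f s \<le> E}\<close>: it is characterized
  by \<open>l n \<le> E \<longleftrightarrow> n < c E\<close>.
\<close>

lemma enumeration_by_sublevel_sets:
  fixes f :: "'s \<Rightarrow> real"
  assumes fin: "\<And>E. finite {s \<in> S. f s \<le> E}"
  obtains I :: "nat set" and l where "I = UNIV \<or> (\<exists>m. I = {..<m})" "mono_on I l"
    "\<forall>\<mu>. finite {n \<in> I. l n = \<mu>}" "\<forall>\<mu>. card {n \<in> I. l n = \<mu>} = card {s \<in> S. f s = \<mu>}"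
proof -
  define c where "c E = card {s \<in> S. f s \<le> E}" for E
  define c' where "c' E = card {s \<in> S. f s < E}" for E
  define I where "I = {n. \<exists>E. n < c E}"
  have c_mono: "c x \<le> c y" if "x \<le> y" for x y
    unfolding c_def using that by (intro card_mono fin) auto
  \<comment> \<open>\<open>c\<close> jumps only at values of \<open>f\<close>; hence the infimum of \<open>{E. n < c E}\<close> is attained\<close>
  have attained: "\<exists>y\<in>f ` T. n < c y" if T: "T \<subseteq> S" "finite T" "n < card T" for n T
  proof (intro bexI)
    have "T \<noteq> {}" using T(3) by auto
    then show "Max (f ` T) \<in> f ` T" using T(2) by (intro Max_in) auto
    have "T \<subseteq> {s \<in> S. f s \<le> Max (f ` T)}" using T by auto
    then have "card T \<le> c (Max (f ` T))" unfolding c_def by (intro card_mono fin)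
    then show "n < c (Max (f ` T))" using T(3) by simp
  qed
  have "\<exists>\<mu>. n < c \<mu> \<and> (\<forall>E. n < c E \<longrightarrow> \<mu> \<le> E)" if "n \<in> I" for n
  proof -
    from that obtain E0 where E0: "n < c E0" by (auto simp: I_def)
    define X where "X = {x \<in> f ` {s \<in> S. f s \<le> E0}. n < c x}"
    have below: "\<exists>y\<in>X. y \<le> E" if "n < c E" "E \<le> E0" for E
    proof -
      have "{s \<in> S. f s \<le> E} \<subseteq> S" by auto
      from attained[OF this fin that(1)[unfolded c_def]]
      obtain y where y: "y \<in> f ` {s \<in> S. f s \<le> E}" "n < c y" by blast
      then show ?thesis using that(2) by (intro bexI[of _ y]) (auto simp: X_def)
    qed
    have X: "finite X" "X \<noteq> {}" using fin below[OF E0] by (auto simp: X_def)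
    have "n < c (Min X)" using Min_in[OF X] by (simp add: X_def)
    moreover have "Min X \<le> E" if "n < c E" for E
    proof (cases "E \<le> E0")
      case True
      then show ?thesis using below[OF that] X Min_le order_trans by blast
    next
      case False
      obtain y where "y \<in> X" "y \<le> E0" using below[OF E0] by auto
      with False show ?thesis using Min_le[OF X(1), of y] by linarith
    qed
    ultimately show ?thesis by blast
  qed
  then obtain l where l: "\<And>n. n \<in> I \<Longrightarrow> n < c (l n)" "\<And>n E. n \<in> I \<Longrightarrow> n < c E \<Longrightarrow> l n \<le> E"
    by metis
  have le: "{n \<in> I. l n \<le> E} = {..<c E}" for E
    using l c_mono by (fastforce simp: I_def)
  have lt: "{n \<in> I. l n < \<mu>} = {..<c' \<mu>}" for \<mu>
  proof (intro set_eqI iffI)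
    fix n assume n: "n \<in> {n \<in> I. l n < \<mu>}"
    then have "{s \<in> S. f s \<le> l n} \<subseteq> {s \<in> S. f s < \<mu>}" by auto
    moreover have "finite {s \<in> S. f s < \<mu>}" by (rule finite_subset[OF _ fin[of \<mu>]]) auto
    ultimately have "c (l n) \<le> c' \<mu>" unfolding c_def c'_def by (intro card_mono)
    then show "n \<in> {..<c' \<mu>}" using l(1)[of n] n by simp
  next
    fix n assume "n \<in> {..<c' \<mu>}"
    then have n: "n < card {s \<in> S. f s < \<mu>}" by (simp add: c'_def)
    have "{s \<in> S. f s < \<mu>} \<subseteq> S" by auto
    moreover have "finite {s \<in> S. f s < \<mu>}" by (rule finite_subset[OF _ fin[of \<mu>]]) auto
    ultimately obtain y where y: "y \<in> f ` {s \<in> S. f s < \<mu>}" "n < c y"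
      using attained[OF _ _ n] by blast
    then have "n \<in> I" by (auto simp: I_def)
    with l(2)[OF this y(2)] y(1) show "n \<in> {n \<in> I. l n < \<mu>}" by auto
  qed
  have eq: "{n \<in> I. l n = \<mu>} = {c' \<mu>..<c \<mu>}" for \<mu>
  proof -
    have "{n \<in> I. l n = \<mu>} = {n \<in> I. l n \<le> \<mu>} - {n \<in> I. l n < \<mu>}" by auto
    then show ?thesis unfolding le lt by auto
  qed
  show thesis
  proof
    have down: "n \<in> I" if "m \<in> I" "n \<le> m" for m n
      using that le_less_trans by (auto simp: I_def)
    show "I = UNIV \<or> (\<exists>m. I = {..<m})"
    proof (cases "I = UNIV")
      case False
      then obtain k where "k \<notin> I" by auto
      then have "(LEAST k. k \<notin> I) \<notin> I" by (rule LeastI)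
      then have "I = {..<(LEAST k. k \<notin> I)}"
        using down not_less_Least by (auto simp: not_less[symmetric])
      then show ?thesis by blast
    qed simp
    show "mono_on I l"
    proof (rule mono_onI)
      fix n m assume "n \<in> I" "m \<in> I" "n \<le> m"
      then show "l n \<le> l m" using l(1)[of m] by (intro l(2)) auto
    qed
    show "\<forall>\<mu>. finite {n \<in> I. l n = \<mu>}" unfolding eq by simp
    show "\<forall>\<mu>. card {n \<in> I. l n = \<mu>} = card {s \<in> S. f s = \<mu>}"
    proof
      fix \<mu>
      have "{s \<in> S. f s = \<mu>} = {s \<in> S. f s \<le> \<mu>} - {s \<in> S. f s < \<mu>}" by auto
      moreover have "finite {s \<in> S. f s < \<mu>}" by (rule finite_subset[OF _ fin[of \<mu>]]) auto
      ultimately have "card {s \<in> S. f s = \<mu>} = c \<mu> - c' \<mu>"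
        unfolding c_def c'_def by (simp add: card_Diff_subset subset_iff)
      then show "card {n \<in> I. l n = \<mu>} = card {s \<in> S. f s = \<mu>}" unfolding eq by simp
    qed
  qed
qed

text \<open>A sublevel set is the disjoint union of the level sets of finitely many values. This is
  applied to an eigenvalue sequence and to an orthonormal system of eigenvectors.\<close>

lemma card_sublevel_set_cong:
  fixes f :: "'s \<Rightarrow> real" and g :: "'t \<Rightarrow> real"
  assumes img: "f ` S = g ` T"
    and fin: "finite {s \<in> S. f s \<le> E}" "\<And>\<mu>. finite {t \<in> T. g t = \<mu>}"
    and card: "\<And>\<mu>. card {s \<in> S. f s = \<mu>} = card {t \<in> T. g t = \<mu>}"
  shows "card {s \<in> S. f s \<le> E} = card {t \<in> T. g t \<le> E}"
proof -
  define M where "M = {\<mu> \<in> f ` S. \<mu> \<le> E}"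
  have "M = f ` {s \<in> S. f s \<le> E}" by (auto simp: M_def)
  then have M: "finite M" using fin(1) by simp
  have finS: "finite {s \<in> S. f s = \<mu>}" if "\<mu> \<in> M" for \<mu>
    by (rule finite_subset[OF _ fin(1)]) (use that in \<open>auto simp: M_def\<close>)
  have "{s \<in> S. f s \<le> E} = (\<Union>\<mu>\<in>M. {s \<in> S. f s = \<mu>})" by (auto simp: M_def)
  then have "card {s \<in> S. f s \<le> E} = (\<Sum>\<mu>\<in>M. card {s \<in> S. f s = \<mu>})"
    using M finS by (simp only:) (rule card_UN_disjoint, auto)
  also have "\<dots> = (\<Sum>\<mu>\<in>M. card {t \<in> T. g t = \<mu>})" by (simp add: card)
  also have "\<dots> = card (\<Union>\<mu>\<in>M. {t \<in> T. g t = \<mu>})"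
    using M fin(2) by (intro card_UN_disjoint[symmetric]) auto
  also have "(\<Union>\<mu>\<in>M. {t \<in> T. g t = \<mu>}) = {t \<in> T. g t \<le> E}"
    unfolding M_def img by auto
  finally show ?thesis .
qed

context selfadjoint_operator
begin

text \<open>The last conjunct is maximality within each eigenspace; if only finitely many members of \<open>S\<close> belong to
  \<open>\<mu>\<close>, it says that they span the eigenspace of \<open>\<mu>\<close>.\<close>

definition maximal_eigensystem :: "'a set \<Rightarrow> ('a \<Rightarrow> real) \<Rightarrow> bool" where
  "maximal_eigensystem S f \<longleftrightarrow> orthonormal S \<and> S \<subseteq> dom B \<and>
     (\<forall>s\<in>S. app s = complex_of_real (f s) *\<^sub>C s) \<and>
     (\<forall>\<mu>. \<forall>u\<in>dom B. app u = complex_of_real \<mu> *\<^sub>C u \<longrightarrow>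
        u \<in> orthogonal_complement {s \<in> S. f s = \<mu>} \<longrightarrow> u = 0)"

text \<open>A maximal orthonormal set of eigenvectors is maximal within each eigenspace, since eigenvectors for other
  eigenvalues are orthogonal to it automatically.\<close>

lemma maximal_eigensystem_exists: obtains S f where "maximal_eigensystem S f"
proof -
  let ?X = "{u \<in> dom B. \<exists>\<mu>. app u = complex_of_real \<mu> *\<^sub>C u}"
  obtain S where S: "S \<subseteq> ?X" "orthonormal S"
    and max: "\<And>x. x \<in> ?X \<Longrightarrow> norm x = 1 \<Longrightarrow> x \<notin> orthogonal_complement S"
    using maximal_orthonormal_subset by blast
  from S(1) have "\<forall>s\<in>S. \<exists>\<mu>. app s = complex_of_real \<mu> *\<^sub>C s" by blast
  then obtain f where f: "\<And>s. s \<in> S \<Longrightarrow> app s = complex_of_real (f s) *\<^sub>C s" by metis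
  have "u = 0" if u: "u \<in> dom B" "app u = complex_of_real \<mu> *\<^sub>C u"
    and o: "u \<in> orthogonal_complement {s \<in> S. f s = \<mu>}" for u \<mu>
  proof (rule ccontr)
    assume "u \<noteq> 0"
    have "cinner u s = 0" if "s \<in> S" for s
    proof (cases "f s = \<mu>")
      case True
      with o that show ?thesis by (simp add: orthogonal_complement_def)
    next
      case False
      with that S(1) show ?thesis
        by (intro eigenvectors_orthogonal[OF u _ f[OF that]]) auto
    qed
    then have u_S: "u \<in> orthogonal_complement S" by (simp add: orthogonal_complement_def)
    define y where "y = complex_of_real (1 / norm u) *\<^sub>C u"
    have "app y = complex_of_real \<mu> *\<^sub>C y"
      using u by (simp add: y_def app_scaleC scaleC_scaleC mult.commute)
    moreover have "y \<in> dom B" unfolding y_def using u(1) by (rule dom_simps)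
    moreover have "y \<in> orthogonal_complement S"
      unfolding y_def by (rule csubspace_scaleC[OF csubspace_orthogonal_complement u_S])
    moreover have "norm y = 1"
      using \<open>u \<noteq> 0\<close> by (simp add: y_def norm_scaleC norm_divide)
    ultimately show False using max by blast
  qed
  moreover have "S \<subseteq> dom B" using S(1) by blast
  ultimately have "maximal_eigensystem S f"
    unfolding maximal_eigensystem_def using S(2) f by (intro conjI ballI allI impI)
  then show thesis by (rule that)
qed

lemma maximal_eigensystemD:
  assumes "maximal_eigensystem S f"
  shows "orthonormal S" "S \<subseteq> dom B" "\<And>s. s \<in> S \<Longrightarrow> app s = complex_of_real (f s) *\<^sub>C s"
    "\<And>\<mu> u. u \<in> dom B \<Longrightarrow> app u = complex_of_real \<mu> *\<^sub>C u \<Longrightarrow>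
      u \<in> orthogonal_complement {s \<in> S. f s = \<mu>} \<Longrightarrow> u = 0"
  using assms unfolding maximal_eigensystem_def by blast+

lemma finite_eigensystem_level:
  assumes cr: "compact_resolvent B" and S: "maximal_eigensystem S f"
  shows "finite {s \<in> S. \<bar>f s\<bar> \<le> r}"
proof (rule finite_orthonormal_eigenvectors[OF cr])
  show "orthonormal {s \<in> S. \<bar>f s\<bar> \<le> r}"
    by (rule orthonormal_subset[OF maximal_eigensystemD(1)[OF S]]) auto
  show "{s \<in> S. \<bar>f s\<bar> \<le> r} \<subseteq> dom B" using maximal_eigensystemD(2)[OF S] by auto
  show "\<exists>a. app s = a *\<^sub>C s \<and> cmod a \<le> r" if "s \<in> {s \<in> S. \<bar>f s\<bar> \<le> r}" for s
    using that maximal_eigensystemD(3)[OF S, of s]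
    by (intro exI[of _ "complex_of_real (f s)"]) auto
qed

lemma finite_eigensystem_sublevel:
  assumes cr: "compact_resolvent B" and sb: "semibounded B" and S: "maximal_eigensystem S f"
  shows "finite {s \<in> S. f s \<le> E}"
proof -
  from sb obtain C where C: "\<And>u. u \<in> dom B \<Longrightarrow> C * (norm u)\<^sup>2 \<le> Re (cinner (app u) u)"
    unfolding semibounded_def by blast
  have "C \<le> f s" if "s \<in> S" for s
  proof -
    have "s \<in> dom B" using maximal_eigensystemD(2)[OF S] that by blast
    from C[OF this] show ?thesis
      using maximal_eigensystemD(3)[OF S that]
        orthonormal_norm[OF maximal_eigensystemD(1)[OF S] that]
      by (simp add: cinner_scaleC_left Re_cinner_self)
  qed
  then have "{s \<in> S. f s \<le> E} \<subseteq> {s \<in> S. \<bar>f s\<bar> \<le> max \<bar>C\<bar> \<bar>E\<bar>}" by fastforce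
  then show ?thesis using finite_eigensystem_level[OF cr S] by (rule finite_subset)
qed

lemma eigensystem_multiplicity:
  assumes cr: "compact_resolvent B" and S: "maximal_eigensystem S f"
  shows "finite {s \<in> S. f s = \<mu>}"
    and "ecdim (ker_op (shift_op B (complex_of_real \<mu>))) = enat (card {s \<in> S. f s = \<mu>})"
proof -
  let ?P = "{s \<in> S. f s = \<mu>}" and ?U = "{u \<in> dom B. app u = complex_of_real \<mu> *\<^sub>C u}"
  show fin: "finite ?P"
    by (rule finite_subset[OF _ finite_eigensystem_level[OF cr S, of "\<bar>\<mu>\<bar>"]]) auto
  have P: "orthonormal ?P"
    by (rule orthonormal_subset[OF maximal_eigensystemD(1)[OF S]]) auto
  have "cspan ?P = ?U"
  proof (rule cspan_maximal_orthonormal[OF P fin _ subspace_eigenspace])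
    show "?P \<subseteq> ?U" using maximal_eigensystemD(2,3)[OF S] by blast
    fix x assume "x \<in> ?U" "norm x = 1"
    then show "x \<notin> orthogonal_complement ?P" using maximal_eigensystemD(4)[OF S, of x \<mu>] by auto
  qed
  with ecdim_cspan_orthonormal[OF P fin]
  show "ecdim (ker_op (shift_op B (complex_of_real \<mu>))) = enat (card ?P)"
    by (simp add: ker_shift_op)
qed

lemma eigensystem_spectrum:
  assumes cr: "compact_resolvent B" and S: "maximal_eigensystem S f"
  shows "spectrum_op B = complex_of_real ` f ` S"
proof -
  have "{\<mu>. \<exists>u\<in>dom B. u \<noteq> 0 \<and> app u = complex_of_real \<mu> *\<^sub>C u} = f ` S"
  proof (intro set_eqI iffI)
    fix \<mu> assume "\<mu> \<in> {\<mu>. \<exists>u\<in>dom B. u \<noteq> 0 \<and> app u = complex_of_real \<mu> *\<^sub>C u}"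
    then obtain u where "u \<in> dom B" "u \<noteq> 0" "app u = complex_of_real \<mu> *\<^sub>C u" by blast
    then have "u \<notin> orthogonal_complement {s \<in> S. f s = \<mu>}"
      using maximal_eigensystemD(4)[OF S] by blast
    then show "\<mu> \<in> f ` S" by (auto simp: orthogonal_complement_def)
  next
    fix \<mu> assume "\<mu> \<in> f ` S"
    then obtain s where "s \<in> S" "\<mu> = f s" by blast
    then have "s \<in> dom B" "s \<noteq> 0" "app s = complex_of_real \<mu> *\<^sub>C s"
      using maximal_eigensystemD(2,3)[OF S] orthonormal_norm[OF maximal_eigensystemD(1)[OF S], of s]
      by auto
    then show "\<mu> \<in> {\<mu>. \<exists>u\<in>dom B. u \<noteq> 0 \<and> app u = complex_of_real \<mu> *\<^sub>C u}" by blast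
  qed
  then show ?thesis using spectrum_eq_eigenvalues[OF cr] by simp
qed

text \<open>The counting function is defined through an arbitrary eigenvalue sequence. Such a sequence exists
  by enumerating the eigensystem, and every one of them has the multiplicities of the eigensystem,
  so the definite description denotes.\<close>

theorem counting_function_eq_card:
  assumes cr: "compact_resolvent B" and sb: "semibounded B" and S: "maximal_eigensystem S f"
  shows "counting_function B E = card {s \<in> S. f s \<le> E}"
proof -
  note fin = finite_eigensystem_sublevel[OF cr sb S]
  note mult = eigensystem_multiplicity[OF cr S]
  have unique: "card {n \<in> I. l n \<le> E} = card {s \<in> S. f s \<le> E}"
    if "eigenvalue_sequence B I l" for I l
  proof (rule card_sublevel_set_cong[symmetric])
    have "complex_of_real ` f ` S = complex_of_real ` l ` I"
      using that eigensystem_spectrum[OF cr S] by (simp add: eigenvalue_sequence_def)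
    then show "f ` S = l ` I"
      by (simp add: inj_image_eq_iff[OF inj_of_real])
    show "card {s \<in> S. f s = \<mu>} = card {n \<in> I. l n = \<mu>}" for \<mu>
    proof -
      have "enat (card {n \<in> I. l n = \<mu>}) = enat (card {s \<in> S. f s = \<mu>})"
        using that unfolding mult(2)[symmetric] eigenvalue_sequence_def by blast
      then show ?thesis by simp
    qed
    show "finite {n \<in> I. l n = \<mu>}" for \<mu>
      using that by (simp add: eigenvalue_sequence_def)
  qed (rule fin)
  obtain I :: "nat set" and l where I: "I = UNIV \<or> (\<exists>m. I = {..<m})" "mono_on I l"
    and "\<forall>\<mu>. finite {n \<in> I. l n = \<mu>}" "\<forall>\<mu>. card {n \<in> I. l n = \<mu>} = card {s \<in> S. f s = \<mu>}"
    by (rule enumeration_by_sublevel_sets[OF fin])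
  then have l: "finite {n \<in> I. l n = \<mu>}" "card {n \<in> I. l n = \<mu>} = card {s \<in> S. f s = \<mu>}" for \<mu>
    by blast+
  have "\<mu> \<in> l ` I \<longleftrightarrow> \<mu> \<in> f ` S" for \<mu>
  proof -
    have "\<mu> \<in> l ` I \<longleftrightarrow> card {n \<in> I. l n = \<mu>} \<noteq> 0" using l(1)[of \<mu>] by auto
    also have "\<dots> \<longleftrightarrow> \<mu> \<in> f ` S" using l(2)[of \<mu>] mult(1)[of \<mu>] by auto
    finally show ?thesis .
  qed
  then have "l ` I = f ` S" by blast
  then have "eigenvalue_sequence B I l"
    unfolding eigenvalue_sequence_def using I l mult(2) eigensystem_spectrum[OF cr S] by simp
  then have "\<exists>I l. eigenvalue_sequence B I l \<and> card {s \<in> S. f s \<le> E} = card {n \<in> I. l n \<le> E}"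
    using unique by (intro exI[of _ I] exI[of _ l]) simp
  moreover have "N = card {s \<in> S. f s \<le> E}"
    if "\<exists>I l. eigenvalue_sequence B I l \<and> N = card {n \<in> I. l n \<le> E}" for N
    using that unique by (elim exE conjE) simp
  ultimately show ?thesis
    unfolding counting_function_def by (rule the_equality)
qed

text \<open>This is the lower half of the variational characterization of the eigenvalues; the upper half is
  immediate from orthonormality and is computed where it is needed, in \<open>counting_function_le\<close>.\<close>

lemma form_gt_on_eigensystem_complement:
  assumes cr: "compact_resolvent B" and sb: "semibounded B" and S: "maximal_eigensystem S f"
    and u: "u \<in> orthogonal_complement {s \<in> S. f s \<le> E}" "u \<in> dom B" "u \<noteq> 0"
  shows "E * (norm u)\<^sup>2 < Re (cinner (app u) u)"
proof -
  from sb obtain C where C: "\<And>u. u \<in> dom B \<Longrightarrow> C * (norm u)\<^sup>2 \<le> Re (cinner (app u) u)"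
    unfolding semibounded_def by blast
  let ?P = "{s \<in> S. f s \<le> E}"
  show ?thesis
  proof (rule form_gt_on_complement[OF cr C _ finite_eigensystem_sublevel[OF cr sb S] _ _ _ u])
    show "orthonormal ?P"
      by (rule orthonormal_subset[OF maximal_eigensystemD(1)[OF S]]) auto
    show "?P \<subseteq> dom B" using maximal_eigensystemD(2)[OF S] by auto
    show "\<exists>a. app p = a *\<^sub>C p" if "p \<in> ?P" for p
      using that maximal_eigensystemD(3)[OF S] by blast
    fix \<mu> v assume "\<mu> \<le> E" "v \<in> orthogonal_complement ?P" "v \<in> dom B"
      "app v = complex_of_real \<mu> *\<^sub>C v"
    then show "v = 0"
      by (intro maximal_eigensystemD(4)[OF S, of v \<mu>]) (auto simp: orthogonal_complement_def)
  qed
qed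

end

section \<open>Pairs of self-adjoint extensions\<close>

text \<open>By symmetry of \<open>B\<close>, \<open>\<langle>A v, u\<rangle> = \<langle>B v, u\<rangle> = \<langle>v, B u\<rangle>\<close> for all \<open>v\<close> in the domain of \<open>A\<close>.\<close>

lemma adjoint_op_extension:
  fixes A B :: "'a::chilbert_space \<rightharpoonup> 'a"
  assumes A: "densely_defined A" and B: "selfadjoint_extension A B" and u: "u \<in> dom B"
  shows "adjoint_op A u = B u"
proof -
  interpret selfadjoint_operator B
    using B by unfold_locales (simp add: selfadjoint_extension_def)
  have "cinner (the (A v)) u = cinner v (app u)" if v: "v \<in> dom A" for v
  proof -
    have AB: "A \<subseteq>\<^sub>m B" using B by (simp add: selfadjoint_extension_def)
    then have "A v = B v" using v by (simp add: map_le_def)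
    moreover have "v \<in> dom B" using map_le_implies_dom_le[OF AB] v by blast
    ultimately show ?thesis using symmetric[of v u] u by simp
  qed
  from adjoint_op_eqI[OF A this] u show ?thesis by auto
qed

text \<open>Membership in the kernel is a family of equations linear in \<open>v\<close>.\<close>

lemma subspace_ker_shift_adjoint:
  assumes A: "densely_defined A"
  shows "csubspace (ker_op (shift_op (adjoint_op A) z))" (is "csubspace ?K")
proof -
  have mem: "v \<in> ?K \<longleftrightarrow> (\<forall>u\<in>dom A. cinner (the (A u)) v = cinner u (z *\<^sub>C v))" for v
  proof
    assume "v \<in> ?K"
    then have "adjoint_op A v = Some (z *\<^sub>C v)" by (auto simp: ker_shift_op)
    from adjoint_opD[OF A this] show "\<forall>u\<in>dom A. cinner (the (A u)) v = cinner u (z *\<^sub>C v)" by blast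
  next
    assume "\<forall>u\<in>dom A. cinner (the (A u)) v = cinner u (z *\<^sub>C v)"
    then have "adjoint_op A v = Some (z *\<^sub>C v)" by (intro adjoint_op_eqI[OF A]) blast
    then show "v \<in> ?K" by (auto simp: ker_shift_op)
  qed
  show ?thesis
  proof (rule complex_vector.subspaceI)
    show "0 \<in> ?K" by (simp add: mem cinner.zero_right)
    show "x + y \<in> ?K" if "x \<in> ?K" "y \<in> ?K" for x y
      using that by (simp add: mem cinner.add_right scaleC_add_right)
    show "a *\<^sub>C x \<in> ?K" if "x \<in> ?K" for a x
      using that by (simp add: mem cinner_scaleC_right mult.left_commute)
  qed
qed

text \<open>If \<open>u\<close> and \<open>v\<close> have the same image \<open>f\<close> under \<open>B1 - \<i>\<close> and \<open>B0 - \<i>\<close>, then \<open>u - v\<close> is the value at \<open>f\<close> of the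
  difference of the two resolvents. The assumption \<open>resolvent_difference\<close> says in these terms that the
  resolvents differ by an operator whose range lies in the span of the finite orthonormal set \<open>P\<close>.
  The condition is symmetric in \<open>B0\<close> and \<open>B1\<close>, so that each comparison below has to be proved in one
  direction only.\<close>

locale finite_rank_pair = B0: selfadjoint_operator B0 + B1: selfadjoint_operator B1
  for B0 B1 :: "'a::chilbert_space \<rightharpoonup> 'a" +
  fixes P :: "'a set"
  assumes P: "finite P" "orthonormal P"
    and resolvent_difference: "\<And>u v. u \<in> dom B1 \<Longrightarrow> v \<in> dom B0 \<Longrightarrow>
      the (B1 u) - \<i> *\<^sub>C u = the (B0 v) - \<i> *\<^sub>C v \<Longrightarrow> u - v = (\<Sum>p\<in>P. cinner (u - v) p *\<^sub>C p)"
begin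

lemma swap: "finite_rank_pair B1 B0 P"
proof
  fix u v assume *: "u \<in> dom B0" "v \<in> dom B1" "the (B0 u) - \<i> *\<^sub>C u = the (B1 v) - \<i> *\<^sub>C v"
  have "u - v = - (v - u)" by simp
  also have "\<dots> = - (\<Sum>p\<in>P. cinner (v - u) p *\<^sub>C p)"
    using resolvent_difference[OF *(2,1) *(3)[symmetric]] by simp
  also have "\<dots> = (\<Sum>p\<in>P. cinner (- (v - u)) p *\<^sub>C p)"
    unfolding cinner.minus_left scaleC.minus_left sum_negf ..
  finally show "u - v = (\<Sum>p\<in>P. cinner (u - v) p *\<^sub>C p)" by simp
qed (fact P)+

lemma resolvent_matching:
  obtains g where "\<And>u. g u \<in> dom B0"
    "\<And>u. B0.app (g u) - \<i> *\<^sub>C g u = B1.app u - \<i> *\<^sub>C u"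
proof -
  have "\<exists>v. v \<in> dom B0 \<and> B0.app v - \<i> *\<^sub>C v = B1.app u - \<i> *\<^sub>C u" for u
    by (rule B0.range_minus_i[of "B1.app u - \<i> *\<^sub>C u"]) blast
  then have "\<forall>u. \<exists>v. v \<in> dom B0 \<and> B0.app v - \<i> *\<^sub>C v = B1.app u - \<i> *\<^sub>C u" by (rule allI)
  from choice[OF this] show thesis using that by blast
qed

text \<open>The two operators agree on the vectors \<open>u\<close> of the domain of \<open>B1\<close> at which the \<open>card P\<close> functionals
  \<open>\<langle>u - r u, p\<rangle>\<close> vanish, where \<open>r u\<close> is the vector matched with \<open>u\<close>: there \<open>u = r u\<close>. Together with
  orthogonality to \<open>J\<close> these are \<open>card P + card J\<close> homogeneous conditions, fewer than there are coefficients.\<close>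

lemma common_combination:
  assumes S: "finite S" "S \<subseteq> dom B1" and J: "finite J" and card: "card P + card J < card S"
  obtains c where "\<exists>s\<in>S. c s \<noteq> 0" "(\<Sum>s\<in>S. c s *\<^sub>C s) \<in> dom B0"
    "B0.app (\<Sum>s\<in>S. c s *\<^sub>C s) = B1.app (\<Sum>s\<in>S. c s *\<^sub>C s)"
    "(\<Sum>s\<in>S. c s *\<^sub>C s) \<in> orthogonal_complement J"
proof -
  obtain r where r: "\<And>u. r u \<in> dom B0"
    "\<And>u. B0.app (r u) - \<i> *\<^sub>C r u = B1.app u - \<i> *\<^sub>C u"
    by (rule resolvent_matching) blast
  define M where "M j s = (case j of Inl p \<Rightarrow> cinner (s - r s) p | Inr t \<Rightarrow> cinner s t)" for j s
  have "card (P <+> J) < card S" using card P(1) J by (simp add: card_Plus)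
  from homogeneous_system_solution[OF _ S(1) this, of M] P(1) J
  obtain c where c: "\<exists>s\<in>S. c s \<noteq> 0" "\<And>j. j \<in> P <+> J \<Longrightarrow> (\<Sum>s\<in>S. c s * M j s) = 0" by auto
  define u where "u = (\<Sum>s\<in>S. c s *\<^sub>C s)"
  define v where "v = (\<Sum>s\<in>S. c s *\<^sub>C r s)"
  have u: "u \<in> dom B1" "B1.app u = (\<Sum>s\<in>S. c s *\<^sub>C B1.app s)"
    using B1.app_combination[of S "\<lambda>s. s", OF subsetD[OF S(2)], of c]
    by (simp_all add: u_def)
  have v: "v \<in> dom B0" "B0.app v = (\<Sum>s\<in>S. c s *\<^sub>C B0.app (r s))"
    unfolding v_def by (rule B0.app_combination, rule r)+
  have uv: "u - v = (\<Sum>s\<in>S. c s *\<^sub>C (s - r s))"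
    by (simp add: u_def v_def scaleC.diff_right sum_subtractf)
  have "B1.app u - \<i> *\<^sub>C u = (\<Sum>s\<in>S. c s *\<^sub>C (B1.app s - \<i> *\<^sub>C s))"
    unfolding u(2) unfolding u_def
    by (simp add: scaleC.diff_right sum_subtractf scaleC.sum_right scaleC_scaleC mult.commute)
  also have "\<dots> = B0.app v - \<i> *\<^sub>C v"
    unfolding v(2) unfolding v_def r(2)[symmetric]
    by (simp add: scaleC.diff_right sum_subtractf scaleC.sum_right scaleC_scaleC mult.commute)
  finally have res: "B1.app u - \<i> *\<^sub>C u = B0.app v - \<i> *\<^sub>C v" .
  have "cinner (u - v) p = 0" if "p \<in> P" for p
    using c(2)[OF InlI[OF that]]
    unfolding uv by (simp add: M_def cinner.sum_left cinner_scaleC_left)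
  then have "u = v" using resolvent_difference[OF u(1) v(1) res] by simp
  moreover have "cinner u t = 0" if "t \<in> J" for t
    using c(2)[OF InrI[OF that]]
    unfolding u_def by (simp add: M_def cinner.sum_left cinner_scaleC_left)
  ultimately show thesis
    using that[OF c(1)] v(1) res unfolding u_def[symmetric]
    by (simp add: orthogonal_complement_def)
qed

text \<open>The graph-bounded set \<open>S\<close> is covered by the sum of two compact sets: the matched vectors, which are
  graph-bounded for \<open>B0\<close>, and the differences, which are bounded in a finite-dimensional space.\<close>

lemma compact_resolvent_transfer:
  assumes cr: "compact_resolvent B0"
  shows "compact_resolvent B1"
  unfolding compact_resolvent_def
proof (intro allI impI)
  fix S assume "S \<subseteq> dom B1 \<and> (\<exists>C. \<forall>u\<in>S. graph_norm B1 u \<le> C)"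
  then obtain C where S: "S \<subseteq> dom B1" "\<And>u. u \<in> S \<Longrightarrow> graph_norm B1 u \<le> C" by blast
  obtain g where g: "\<And>u. g u \<in> dom B0"
    "\<And>u. B0.app (g u) - \<i> *\<^sub>C g u = B1.app u - \<i> *\<^sub>C u"
    by (rule resolvent_matching) blast
  have gn0: "graph_norm B0 v = norm (B0.app v - \<i> *\<^sub>C v)" if "v \<in> dom B0" for v
    unfolding graph_norm_def using B0.norm_app_minus_i[OF that]
    by (metis add.commute norm_ge_zero real_sqrt_unique)
  have gn1: "graph_norm B1 v = norm (B1.app v - \<i> *\<^sub>C v)" if "v \<in> dom B1" for v
    unfolding graph_norm_def using B1.norm_app_minus_i[OF that]
    by (metis add.commute norm_ge_zero real_sqrt_unique)
  have g_le: "graph_norm B0 (g u) \<le> C" if "u \<in> S" for u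
    using S(2)[OF that] gn0[OF g(1)[of u]] gn1[OF subsetD[OF S(1) that]] g(2)[of u] by simp
  then have "\<forall>v\<in>g ` S. graph_norm B0 v \<le> C" by blast
  then have F: "compact (closure (g ` S))"
    using cr[unfolded compact_resolvent_def, rule_format, of "g ` S"] g(1) by blast
  let ?K = "{(\<Sum>p\<in>P. c p *\<^sub>C p) | c. \<forall>p\<in>P. cmod (c p) \<le> 2 * C}"
  let ?T = "{x + y | x y. x \<in> closure (g ` S) \<and> y \<in> ?K}"
  have T: "compact ?T" by (rule compact_sums[OF F compact_sum_scaled[OF P(1)]])
  have "S \<subseteq> ?T"
  proof
    fix u assume u: "u \<in> S"
    have n0: "norm v \<le> graph_norm B0 v" "norm v \<le> graph_norm B1 v" for v
      unfolding graph_norm_def by (rule real_le_rsqrt, simp)+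
    have "norm (u - g u) \<le> norm u + norm (g u)" by (rule norm_triangle_ineq4)
    also have "\<dots> \<le> 2 * C"
      using n0(2)[of u] n0(1)[of "g u"] g_le[OF u] S(2)[OF u] by linarith
    finally have "cmod (cinner (u - g u) p) \<le> 2 * C" if "p \<in> P" for p
      using norm_cinner_le[of "u - g u" p] orthonormal_norm[OF P(2) that] by simp
    moreover have "u - g u = (\<Sum>p\<in>P. cinner (u - g u) p *\<^sub>C p)"
      using resolvent_difference[of u "g u"] S(1) u g by auto
    ultimately have "u - g u \<in> ?K" by blast
    moreover have "g u \<in> closure (g ` S)" using u by (intro subsetD[OF closure_subset] imageI)
    moreover have "u = g u + (u - g u)" by simp
    ultimately show "u \<in> ?T" by blast
  qed
  then have "closure S \<subseteq> ?T" using T by (intro closure_minimal compact_imp_closed)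
  then have eq: "closure S \<inter> ?T = closure S" by (rule Int_absorb2)
  show "compact (closure S)" using closed_Int_compact[OF closed_closure T, of S] unfolding eq .
qed

text \<open>Let \<open>C\<close> be a lower bound of \<open>B0\<close> and \<open>q\<close> the form of \<open>L = B1 - C\<close>. A family \<open>Q\<close> with \<open>q(s, t) = - \<delta>\<^sub>s\<^sub>t\<close> spans a
  subspace on which \<open>q\<close> is negative definite, while \<open>q\<close> is nonnegative wherever \<open>B1\<close> agrees with \<open>B0\<close>;
  hence \<open>Q\<close> has at most \<open>card P\<close> members. For a largest such family, \<open>q\<close> is nonnegative on the
  \<open>q\<close>-orthogonal complement of \<open>Q\<close>, and splitting off the component \<open>w\<close> of \<open>u\<close> along \<open>Q\<close> costs at most
  \<open>\<Sum>\<^sub>s \<bar>q(u, s)\<bar>\<^sup>2 = \<Sum>\<^sub>s \<bar>\<langle>u, L s\<rangle>\<bar>\<^sup>2\<close>, a bounded multiple of \<open>\<parallel>u\<parallel>\<^sup>2\<close>.\<close>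

lemma semibounded_transfer:
  assumes sb: "semibounded B0"
  shows "semibounded B1"
proof -
  from sb obtain C where C: "\<And>u. u \<in> dom B0 \<Longrightarrow> C * (norm u)\<^sup>2 \<le> Re (cinner (B0.app u) u)"
    unfolding semibounded_def by blast
  define L where "L u = B1.app u - complex_of_real C *\<^sub>C u" for u
  have L_add: "L (u + v) = L u + L v" if "u \<in> dom B1" "v \<in> dom B1" for u v
    using that by (simp add: L_def B1.app_add scaleC_add_right)
  have L_scaleC: "L (a *\<^sub>C u) = a *\<^sub>C L u" if "u \<in> dom B1" for a u
    using that by (simp add: L_def B1.app_scaleC scaleC.diff_right scaleC_scaleC mult.commute)
  have L_sym: "cinner (L u) v = cinner u (L v)" if "u \<in> dom B1" "v \<in> dom B1" for u v
    using B1.symmetric[OF that]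
    by (simp add: L_def cinner.diff_left cinner.diff_right cinner_scaleC_left cinner_scaleC_right)
  have L_real: "cinner (L u) u = complex_of_real (Re (cinner (L u) u))" if "u \<in> dom B1" for u
    using L_sym[OF that that] cinner_commute[of "L u" u] by (simp add: complex_eq_iff)
  have L_Re: "Re (cinner (L u) u) = Re (cinner (B1.app u) u) - C * (norm u)\<^sup>2" for u
    by (simp add: L_def cinner.diff_left cinner_scaleC_left Re_cinner_self)
  define negative where "negative Q \<longleftrightarrow> finite Q \<and> Q \<subseteq> dom B1 \<and>
    (\<forall>s\<in>Q. \<forall>t\<in>Q. cinner (L s) t = (if s = t then - 1 else 0))" for Q
  have combination: "(\<Sum>s\<in>Q. c s *\<^sub>C s) \<in> dom B1"
    "t \<in> Q \<Longrightarrow> cinner (L (\<Sum>s\<in>Q. c s *\<^sub>C s)) t = - c t"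
    "cinner (L (\<Sum>s\<in>Q. c s *\<^sub>C s)) (\<Sum>s\<in>Q. c s *\<^sub>C s) = - complex_of_real (\<Sum>s\<in>Q. (cmod (c s))\<^sup>2)"
    if Q: "negative Q" for Q c t
  proof -
    let ?w = "\<Sum>s\<in>Q. c s *\<^sub>C s"
    have fin: "finite Q" and dom: "\<And>s. s \<in> Q \<Longrightarrow> s \<in> dom B1" using Q by (auto simp: negative_def)
    show "?w \<in> dom B1" by (rule B1.app_combination(1)[of Q "\<lambda>s. s", OF dom])
    have L_sum: "L ?w = (\<Sum>s\<in>Q. c s *\<^sub>C L s)"
      using B1.app_combination(2)[of Q "\<lambda>s. s" c, OF dom]
      by (simp add: L_def scaleC.diff_right scaleC.sum_right scaleC_scaleC sum_subtractf mult.commute)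
    have L_w: "cinner (L ?w) t = - c t" if t: "t \<in> Q" for t
    proof -
      have "cinner (\<Sum>s\<in>Q. c s *\<^sub>C L s) t = (\<Sum>s\<in>Q. if s = t then - c s else 0)"
        unfolding cinner.sum_left cinner_scaleC_left
        using Q t by (intro sum.cong) (auto simp: negative_def)
      also have "\<dots> = - c t" using fin t by simp
      finally show ?thesis using L_sum by simp
    qed
    then show "t \<in> Q \<Longrightarrow> cinner (L ?w) t = - c t" .
    have "cinner (L ?w) ?w = (\<Sum>s\<in>Q. cnj (c s) * (- c s))"
      unfolding cinner.sum_right cinner_scaleC_right by (intro sum.cong refl) (simp only: L_w)
    also have "\<dots> = - complex_of_real (\<Sum>s\<in>Q. (cmod (c s))\<^sup>2)"
      by (simp add: sum_negf complex_norm_square mult.commute del: of_real_power)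
    finally show "cinner (L ?w) ?w = - complex_of_real (\<Sum>s\<in>Q. (cmod (c s))\<^sup>2)" .
  qed
  have card_le: "card Q \<le> card P" if Q: "negative Q" for Q
  proof (rule ccontr)
    assume "\<not> card Q \<le> card P"
    then have "card P + card ({} :: 'a set) < card Q" by simp
    moreover have "finite Q" "Q \<subseteq> dom B1" using Q by (simp_all add: negative_def)
    ultimately obtain c where c: "\<exists>s\<in>Q. c s \<noteq> 0" "(\<Sum>s\<in>Q. c s *\<^sub>C s) \<in> dom B0"
      "B0.app (\<Sum>s\<in>Q. c s *\<^sub>C s) = B1.app (\<Sum>s\<in>Q. c s *\<^sub>C s)"
      using common_combination[of Q "{}"] by blast
    have "0 < (\<Sum>s\<in>Q. (cmod (c s))\<^sup>2)"
    proof -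
      obtain s where "s \<in> Q" "c s \<noteq> 0" using c(1) by blast
      then show ?thesis using Q unfolding negative_def by (intro sum_pos2[of Q s]) auto
    qed
    then have "Re (cinner (L (\<Sum>s\<in>Q. c s *\<^sub>C s)) (\<Sum>s\<in>Q. c s *\<^sub>C s)) < 0"
      unfolding combination(3)[OF Q] by simp
    then show False unfolding L_Re using C[OF c(2)] c(3) by simp
  qed
  have "\<exists>Q. negative Q \<and> (\<forall>R. negative R \<longrightarrow> card R \<le> card Q)"
    using ex_has_greatest_nat[of negative "{}" card "Suc (card P)"] card_le
    by (auto simp: negative_def less_Suc_eq_le)
  then obtain Q where Q: "negative Q" and max: "\<And>R. negative R \<Longrightarrow> card R \<le> card Q" by blast
  define K where "K = (\<Sum>s\<in>Q. (norm (L s))\<^sup>2)"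
  have "(C - K) * (norm u)\<^sup>2 \<le> Re (cinner (B1.app u) u)" if u: "u \<in> dom B1" for u
  proof -
    define w where "w = (\<Sum>s\<in>Q. cinner (L u) s *\<^sub>C s)"
    \<comment> \<open>the sign is \<open>+\<close> because the members of \<open>Q\<close> have \<open>q(s, s) = - 1\<close>\<close>
    define x where "x = u + w"
    have w: "w \<in> dom B1" unfolding w_def by (rule combination(1)[OF Q])
    have x: "x \<in> dom B1" unfolding x_def using u w by (rule B1.dom_simps)
    have xt: "cinner (L x) t = 0" if "t \<in> Q" for t
      using combination(2)[OF Q that, of "cinner (L u)"]
      by (simp add: x_def L_add u w cinner_add_left) (simp add: w_def)
    have x_nonneg: "0 \<le> Re (cinner (L x) x)"
    proof (rule ccontr)
      assume "\<not> 0 \<le> Re (cinner (L x) x)"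
      then have neg: "Re (cinner (L x) x) < 0" by simp
      \<comment> \<open>scaling \<open>x\<close> to \<open>q(y, y) = - 1\<close> would enlarge \<open>Q\<close>\<close>
      define a where "a = 1 / sqrt (- Re (cinner (L x) x))"
      have a: "a * a * Re (cinner (L x) x) = - 1"
        using neg by (simp add: a_def)
      define y where "y = complex_of_real a *\<^sub>C x"
      have y: "y \<in> dom B1" unfolding y_def using x by (rule B1.dom_simps)
      have "cinner (L y) y = complex_of_real (a * a * Re (cinner (L x) x))"
        using L_real[OF x]
        by (simp add: y_def L_scaleC[OF x] cinner_scaleC_left cinner_scaleC_right)
      then have yy: "cinner (L y) y = - 1" unfolding a by simp
      have yt: "cinner (L y) t = 0" "cinner (L t) y = 0" if "t \<in> Q" for t
      proof -
        show 1: "cinner (L y) t = 0"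
          using xt[OF that] by (simp add: y_def L_scaleC[OF x] cinner_scaleC_left)
        have "t \<in> dom B1" using Q that by (auto simp: negative_def)
        then show "cinner (L t) y = 0"
          using 1 L_sym[OF _ y, of t] cinner_commute[of t "L y"] by simp
      qed
      have "y \<notin> Q" using yt(1)[of y] yy by auto
      have "negative (insert y Q)"
        using Q y yy yt \<open>y \<notin> Q\<close> by (auto simp: negative_def)
      from max[OF this] \<open>y \<notin> Q\<close> Q show False by (simp add: negative_def)
    qed
    have xw: "cinner (L x) w = 0"
      unfolding w_def cinner.sum_right cinner_scaleC_right
      by (intro sum.neutral ballI) (simp only: xt mult_zero_right)
    then have wx: "cinner (L w) x = 0"
      using L_sym[OF w x] cinner_commute[of w "L x"] by simp
    have "L x = L u + L w" unfolding x_def using u w by (rule L_add)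
    then have Lu: "L u = L x - L w" by simp
    have "cinner (L u) u = cinner (L x - L w) (x - w)" unfolding Lu by (simp add: x_def)
    also have "\<dots> = cinner (L x) x + cinner (L w) w"
      by (simp add: cinner.diff_left cinner.diff_right xw wx)
    also have "cinner (L w) w = - complex_of_real (\<Sum>s\<in>Q. (cmod (cinner (L u) s))\<^sup>2)"
      unfolding w_def by (rule combination(3)[OF Q])
    finally have "Re (cinner (L u) u) \<ge> - (\<Sum>s\<in>Q. (cmod (cinner (L u) s))\<^sup>2)"
      using x_nonneg by simp
    moreover have "(\<Sum>s\<in>Q. (cmod (cinner (L u) s))\<^sup>2) \<le> K * (norm u)\<^sup>2"
      unfolding K_def sum_distrib_right
    proof (rule sum_mono)
      fix s assume "s \<in> Q"
      then have "s \<in> dom B1" using Q by (auto simp: negative_def)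
      from L_sym[OF u this] show "(cmod (cinner (L u) s))\<^sup>2 \<le> (norm (L s))\<^sup>2 * (norm u)\<^sup>2"
        using power_mono[OF norm_cinner_le[of u "L s"] norm_ge_zero, of 2]
        by (simp add: power_mult_distrib mult.commute)
    qed
    ultimately show ?thesis unfolding L_Re by (simp add: algebra_simps)
  qed
  then show ?thesis unfolding semibounded_def by blast
qed

text \<open>If \<open>B1\<close> had more than \<open>card P\<close> eigenvalues up to \<open>E\<close> in excess of those of \<open>B0\<close>, some nonzero combination
  \<open>u\<close> of the corresponding eigenvectors would have \<open>B0 u = B1 u\<close> and be orthogonal to the eigenvectors of
  \<open>B0\<close> up to \<open>E\<close>. Then \<open>\<langle>B1 u, u\<rangle> \<le> E \<parallel>u\<parallel>\<^sup>2 < \<langle>B0 u, u\<rangle>\<close>, which is absurd.\<close>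

lemma counting_function_le:
  assumes cr: "compact_resolvent B0" and sb: "semibounded B0"
  shows "counting_function B1 E \<le> counting_function B0 E + card P"
proof (rule ccontr)
  assume less: "\<not> counting_function B1 E \<le> counting_function B0 E + card P"
  note cr1 = compact_resolvent_transfer[OF cr] and sb1 = semibounded_transfer[OF sb]
  obtain S0 f0 where S0: "B0.maximal_eigensystem S0 f0" by (rule B0.maximal_eigensystem_exists)
  obtain S1 f1 where S1: "B1.maximal_eigensystem S1 f1" by (rule B1.maximal_eigensystem_exists)
  let ?T0 = "{s \<in> S0. f0 s \<le> E}" and ?T1 = "{s \<in> S1. f1 s \<le> E}"
  note S1D = B1.maximal_eigensystemD[OF S1]
  have fin: "finite ?T0" "finite ?T1"
    by (rule B0.finite_eigensystem_sublevel[OF cr sb S0],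
        rule B1.finite_eigensystem_sublevel[OF cr1 sb1 S1])
  have "card P + card ?T0 < card ?T1"
    using less unfolding B0.counting_function_eq_card[OF cr sb S0]
      B1.counting_function_eq_card[OF cr1 sb1 S1] by simp
  moreover have "?T1 \<subseteq> dom B1" using S1D(2) by auto
  ultimately obtain c where c: "\<exists>s\<in>?T1. c s \<noteq> 0" "(\<Sum>s\<in>?T1. c s *\<^sub>C s) \<in> dom B0"
    "B0.app (\<Sum>s\<in>?T1. c s *\<^sub>C s) = B1.app (\<Sum>s\<in>?T1. c s *\<^sub>C s)"
    "(\<Sum>s\<in>?T1. c s *\<^sub>C s) \<in> orthogonal_complement ?T0"
    using common_combination[OF fin(2) _ fin(1)] by blast
  define u where "u = (\<Sum>s\<in>?T1. c s *\<^sub>C s)"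
  note c = c[folded u_def]
  have T1: "orthonormal ?T1" by (rule orthonormal_subset[OF S1D(1)]) auto
  have ut: "cinner u t = c t" if "t \<in> ?T1" for t
    unfolding u_def by (rule cinner_sum_orthonormal[OF T1 fin(2) that])
  have "u \<noteq> 0" using c(1) ut by (auto simp: cinner.zero_left)
  have expand: "cinner (\<Sum>s\<in>?T1. b s *\<^sub>C s) u = (\<Sum>s\<in>?T1. b s * cnj (c s))" for b
    unfolding cinner.sum_left cinner_scaleC_left
    by (intro sum.cong refl) (use ut cinner_commute in metis)
  have "B1.app u = (\<Sum>s\<in>?T1. c s *\<^sub>C B1.app s)"
    unfolding u_def using S1D(2) by (intro B1.app_combination(2)[where f="\<lambda>s. s"]) auto
  also have "\<dots> = (\<Sum>s\<in>?T1. (c s * complex_of_real (f1 s)) *\<^sub>C s)"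
    by (intro sum.cong refl) (simp add: S1D(3) scaleC_scaleC)
  finally have "cinner (B1.app u) u = (\<Sum>s\<in>?T1. (c s * complex_of_real (f1 s)) * cnj (c s))"
    by (simp only: expand)
  also have "\<dots> = complex_of_real (\<Sum>s\<in>?T1. f1 s * (cmod (c s))\<^sup>2)"
    unfolding of_real_sum
    by (intro sum.cong refl) (simp add: complex_norm_square mult_ac del: of_real_power)
  finally have "Re (cinner (B1.app u) u) = (\<Sum>s\<in>?T1. f1 s * (cmod (c s))\<^sup>2)" by simp
  also have "\<dots> \<le> (\<Sum>s\<in>?T1. E * (cmod (c s))\<^sup>2)"
    by (intro sum_mono mult_right_mono) auto
  also have "\<dots> = E * (norm u)\<^sup>2"
  proof -
    have "cinner u u = complex_of_real (\<Sum>s\<in>?T1. (cmod (c s))\<^sup>2)"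
      using expand[of c] unfolding u_def[symmetric] of_real_sum
      by (simp add: complex_norm_square del: of_real_power)
    then have "(norm u)\<^sup>2 = (\<Sum>s\<in>?T1. (cmod (c s))\<^sup>2)"
      unfolding Re_cinner_self[symmetric] by simp
    then show ?thesis by (simp add: sum_distrib_left)
  qed
  also have "\<dots> < Re (cinner (B0.app u) u)"
    using B0.form_gt_on_eigensystem_complement[OF cr sb S0 c(4,2) \<open>u \<noteq> 0\<close>] .
  finally show False using c(3) by simp
qed

end

text \<open>Both extensions are restrictions of the adjoint of \<open>A\<close>, so the difference of two matched vectors lies in the
  deficiency space \<open>ker (A\<^sup>* - \<i>)\<close>, for which \<open>P\<close> is an orthonormal basis.\<close>

lemma finite_rank_pair_of_extensions:
  fixes A B0 B1 :: "'a::chilbert_space \<rightharpoonup> 'a"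
  assumes A: "densely_defined A" and d: "deficiency_index_plus A = enat d"
    and B0: "selfadjoint_extension A B0" and B1: "selfadjoint_extension A B1"
  obtains P where "finite_rank_pair B0 B1 P" "card P = d"
proof -
  interpret B0: selfadjoint_operator B0
    using B0 by unfold_locales (simp add: selfadjoint_extension_def)
  interpret B1: selfadjoint_operator B1
    using B1 by unfold_locales (simp add: selfadjoint_extension_def)
  let ?K = "ker_op (shift_op (adjoint_op A) \<i>)"
  note K = subspace_ker_shift_adjoint[OF A, of \<i>]
  obtain P where P: "orthonormal P" "finite P" "card P = d"
    "\<And>x. x \<in> ?K \<Longrightarrow> x = (\<Sum>p\<in>P. cinner x p *\<^sub>C p)"
    using orthonormal_basis_exists[OF K d[unfolded deficiency_index_plus_def]] by metis
  have "u - v \<in> ?K"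
    if u: "u \<in> dom B1" and v: "v \<in> dom B0" and eq: "B1.app u - \<i> *\<^sub>C u = B0.app v - \<i> *\<^sub>C v" for u v
  proof -
    have "cinner (the (A x)) (u - v) = cinner x (\<i> *\<^sub>C (u - v))" if x: "x \<in> dom A" for x
    proof -
      have "adjoint_op A u = Some (B1.app u)" "adjoint_op A v = Some (B0.app v)"
        using adjoint_op_extension[OF A B1 u] adjoint_op_extension[OF A B0 v] u v by auto
      then have "cinner (the (A x)) (u - v) = cinner x (B1.app u - B0.app v)"
        using adjoint_opD[OF A _ x] by (simp add: cinner.diff_right)
      also have "B1.app u - B0.app v = \<i> *\<^sub>C (u - v)"
        using eq by (simp add: scaleC.diff_right algebra_simps)
      finally show ?thesis .
    qed
    from adjoint_op_eqI[OF A this] show ?thesis by (auto simp: ker_shift_op)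
  qed
  then have "finite_rank_pair B0 B1 P" using P by unfold_locales auto
  then show thesis using that P(3) by blast
qed

theorem theorem3:
  fixes A A\<^sub>0 :: "'a::chilbert_space \<rightharpoonup> 'a" and d :: nat
  assumes "densely_defined A" and "symmetric_op A"
    and "deficiency_index_plus A = enat d" and "deficiency_index_minus A = enat d"
    and "selfadjoint_extension A A\<^sub>0"
    and "compact_resolvent A\<^sub>0" and "semibounded A\<^sub>0"
  shows "(\<forall>A\<^sub>1. selfadjoint_extension A A\<^sub>1 \<and> A\<^sub>1 \<noteq> A\<^sub>0 \<longrightarrow>
            compact_resolvent A\<^sub>1 \<and> semibounded A\<^sub>1) \<and>
         (\<forall>A\<^sub>1. selfadjoint_extension A A\<^sub>1 \<and> A\<^sub>1 \<noteq> A\<^sub>0 \<longrightarrow>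
            (\<forall>E::real. \<bar>int (counting_function A\<^sub>1 E) - int (counting_function A\<^sub>0 E)\<bar> \<le> int d))"
proof -
  have "(compact_resolvent A\<^sub>1 \<and> semibounded A\<^sub>1) \<and>
      (\<forall>E. \<bar>int (counting_function A\<^sub>1 E) - int (counting_function A\<^sub>0 E)\<bar> \<le> int d)"
    if A1: "selfadjoint_extension A A\<^sub>1" for A\<^sub>1
  proof -
    obtain P where pair: "finite_rank_pair A\<^sub>0 A\<^sub>1 P" and card_P: "card P = d"
      using finite_rank_pair_of_extensions[OF assms(1,3,5) A1] .
    interpret finite_rank_pair A\<^sub>0 A\<^sub>1 P by (fact pair)
    have 1: "compact_resolvent A\<^sub>1" "semibounded A\<^sub>1"
      using compact_resolvent_transfer semibounded_transfer assms(6,7) by blast+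
    have "\<bar>int (counting_function A\<^sub>1 E) - int (counting_function A\<^sub>0 E)\<bar> \<le> int d" for E
      using counting_function_le[OF assms(6,7), of E]
        finite_rank_pair.counting_function_le[OF swap 1, of E] unfolding card_P by linarith
    with 1 show ?thesis by blast
  qed
  then show ?thesis by blast
qed

end
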